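(* Consider the uncertain closed-loop system $x(t+1)=A_dx(t)+B_d\pi(x(t))$ with $A_d\in[\underline A_d,\overline A_d]\subset\mathbb R^{n\times n}$, $B_d\in[\underline B_d,\overline B_d]\subset\mathbb R^{n\times m}$, where $\pi$ is the given $\ell$-layer feedforward network with $\pi(0)=0$. Let $x_*=0$, $u_*=0$, and let $v_*,w_*\in\mathbb R^{n_\phi}$ be the corresponding equilibrium activation inputs and outputs. Let $\overline v^1\in\mathbb R^{n_1}$, and let $\alpha_\phi\le\beta_\phi$ in $\mathbb R^{n_\phi}$ be given. With $\hat n=2n+n_\phi$ and $D$, $Z(\lambda,P)$, $U$, $V$ and condition (N) as defined in the context, the following three statements are equivalent. (LMI-I) There exist a symmetric positive definite $P\in\mathbb R^{n\times n}$, $\lambda\in\mathbb R^{n_\phi}_{\ge0}$ and scalars $\gamma_{ij}>0$ ($1\le i\le\hat n$, $1\le j\le n$) such that (N) holds and $$\begin{bmatrix}Z(\lambda,P)+\sum_{i=1}^{\hat n}\sum_{j=1}^n\gamma_{ij}(D(i,j))^2e_ie_i^\top&U\\ *&-V\end{bmatrix}\prec0.$$ (LMI-II) There exist a symmetric positive definite $P\in\mathbb R^{n\times n}$, $\lambda\in\mathbb R^{n_\phi}_{\ge0}$ and diagonal matrices $T\in\mathbb R^{\hat n\times\hat n}$, $S\in\mathbb R^{n\times n}$ such that (N) holds, $DSD^\top\prec T$, and $$\begin{bmatrix}Z(\lambda,P)+T&*\\ \begin{bmatrix}0_{n\times(n+n_\phi)}&P\end{bmatrix}&-S\end{bmatrix}\prec0.$$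 (LMI-III) There exist a symmetric positive definite $P\in\mathbb R^{n\times n}$, $\lambda\in\mathbb R^{n_\phi}_{\ge0}$, scalars $\gamma_{ij}>0$ ($1\le i\le\hat n$, $1\le j\le n$) and a symmetric $Y\in\mathbb R^{\hat n\times\hat n}$ such that (N) holds, $Y\prec-Z(\lambda,P)$, and $$\begin{bmatrix}Y-\sum_{i=1}^{\hat n}\sum_{j=1}^n\gamma_{ij}(D(i,j))^2e_ie_i^\top&U\\ *&V\end{bmatrix}\succ0.$$
   Context: Inequalities $\le,\ge$ between vectors or matrices are entrywise; $\prec,\preceq,\succ,\succeq$ refer to definiteness of symmetric matrices; $*$ denotes a block determined by symmetry. For $\underline A\le\overline A$, $[\underline A,\overline A]$ is the set of matrices $A$ with $\underline A(i,j)\le A(i,j)\le\overline A(i,j)$ for all $i,j$. Network: $\pi:\mathbb R^n\to\mathbb R^m$ is given by $w^0=x$, $v^i=W^iw^{i-1}+b^i$, $w^i=\phi^i(v^i)$ for $i=1,\dots,\ell$, $\pi(x)=W^{\ell+1}w^\ell+b^{\ell+1}$, with $n_0=n$, $W^i\in\mathbb R^{n_i\times n_{i-1}}$, $b^i\in\mathbb R^{n_i}$ for $i\le\ell$, $W^{\ell+1}\in\mathbb R^{m\times n_\ell}$, $b^{\ell+1}\in\mathbb R^m$, and $\phi^i$ applying a scalar activation function $\varphi:\mathbb R\to\mathbb R$ entrywise. It is assumed that $\pi(0)=0$. Let $n_\phi=\sum_{i=1}^\ell n_i$, let $v_\phi,w_\phi\in\mathbb R^{n_\phi}$ be the stacked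 vectors $(v^1,\dots,v^\ell)$, $(w^1,\dots,w^\ell)$. The vectors $v_*=(v_*^1,\dots,v_*^\ell)$ and $w_*$ are the values of $v_\phi,w_\phi$ at input $x=0$; $v_{*,i}^1$ and $\overline v_i^1$ are the $i$-th entries of $v_*^1$ and $\overline v^1$. The matrices $N_{vx},N_{vw},N_{ux},N_{uw}$ are defined by writing $v_\phi=N_{vx}x+N_{vw}w_\phi+N_{vb}$ and $u=\pi(x)=N_{ux}x+N_{uw}w_\phi+N_{ub}$: $N_{vx}\in\mathbb R^{n_\phi\times n}$ has first block row $W^1$ and all other block rows zero; $N_{vw}\in\mathbb R^{n_\phi\times n_\phi}$ has block $W^{i}$ in block position $(i,i-1)$ for $i=2,\dots,\ell$ and zeros elsewhere; $N_{ux}=0_{m\times n}$; $N_{uw}=[0\ \cdots\ 0\ W^{\ell+1}]\in\mathbb R^{m\times n_\phi}$. Matrices: $$R_V=\begin{bmatrix}I_n&0_{n\times n_\phi}\\N_{ux}&N_{uw}\end{bmatrix},\quad R_\phi=\begin{bmatrix}N_{vx}&N_{vw}\\0_{n_\phi\times n}&I_{n_\phi}\end{bmatrix},\quad \Psi_\phi=\begin{bmatrix}\operatorname{diag}(\beta_\phi)&-I_{n_\phi}\\-\operatorname{diag}(\alpha_\phi)&I_{n_\phi}\end{bmatrix},$$ $$M_\phi(\lambda)=\begin{bmatrix}0&\operatorname{diag}(\lambda)\\\operatorname{diag}(\lambda)&0\end{bmatrix},\quad X(\lambda)=R_\phi^\top\Psi_\phi^\top M_\phi(\lambda)\Psi_\phi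 R_\phi.$$ Let $A_0=\frac12(\overline A_d+\underline A_d)$, $A_r=\frac12(\overline A_d-\underline A_d)$. Let $\underline B_N,\overline B_N\in\mathbb R^{n\times n_\phi}$ be the entrywise infimum and supremum of $B_dN_{uw}$ over $B_d\in[\underline B_d,\overline B_d]$, and $\tilde B_0=\frac12(\overline B_N+\underline B_N)$, $\tilde B_r=\frac12(\overline B_N-\underline B_N)$. Put $D=[A_r\ \ \tilde B_r\ \ 0_{n\times n}]^\top\in\mathbb R^{\hat n\times n}$, let $e_i\in\mathbb R^{\hat n}$ be the $i$-th standard basis vector, and $$Z(\lambda,P)=\begin{bmatrix}-R_V^\top\begin{bmatrix}I_n\\0_{m\times n}\end{bmatrix}P\begin{bmatrix}I_n&0_{n\times m}\end{bmatrix}R_V+X(\lambda)&*\\P\begin{bmatrix}A_0&\tilde B_0\end{bmatrix}&-P\end{bmatrix}\in\mathbb R^{\hat n\times\hat n}.$$ For scalars $\gamma_{ij}$, $V=\operatorname{diag}(\gamma_{11},\dots,\gamma_{1n},\dots,\gamma_{\hat n1},\dots,\gamma_{\hat nn})$ and $$U=\begin{bmatrix}0_{(n+n_\phi)\times n}&\cdots&0_{(n+n_\phi)\times n}\\P&\cdots&P\end{bmatrix}\in\mathbb R^{\hat n\times\hat nn}\quad(\hat n\text{ block columns}).$$ Condition (N) on $P$: $\begin{bmatrix}(\overline v_i^1-v_{*,i}^1)^2&W_i^1\\(W_i^1)^\top&P\end{bmatrix}\succeq0$ for all $i\in\{1,\dots,n_1\}$, where $W_i^1$ is the $i$-th row of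 $W^1$. *)

theory Defs
  imports Complex_Main "Jordan_Normal_Form.Matrix"
begin

section \<open>Definiteness and block matrices\<close>

text \<open>On matrices and vectors of \<^theory>\<open>Jordan_Normal_Form.Matrix\<close>, the relation \<open>\<le>\<close> is
  entrywise and includes equality of dimensions, so that \<open>{L..U}\<close> is the interval of matrices
  (of the dimensions of \<open>L\<close> and \<open>U\<close>) lying entrywise between \<open>L\<close> and \<open>U\<close>. Rows and columns
  are numbered from \<open>0\<close>.\<close>

definition symmetric_mat :: "real mat \<Rightarrow> bool" where
  "symmetric_mat A \<longleftrightarrow> square_mat A \<and> transpose_mat A = A"

definition pos_def :: "real mat \<Rightarrow> bool" where
  "pos_def A \<longleftrightarrow> symmetric_mat A \<and>
     (\<forall>v \<in> carrier_vec (dim_row A). v \<noteq> 0\<^sub>v (dim_row A) \<longrightarrow> 0 < v \<bullet> (A *\<^sub>v v))"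

definition pos_semidef :: "real mat \<Rightarrow> bool" where
  "pos_semidef A \<longleftrightarrow> symmetric_mat A \<and>
     (\<forall>v \<in> carrier_vec (dim_row A). 0 \<le> v \<bullet> (A *\<^sub>v v))"

definition def_less :: "real mat \<Rightarrow> real mat \<Rightarrow> bool" (infix \<open>\<prec>\<^sub>d\<close> 50) where
  "A \<prec>\<^sub>d B \<longleftrightarrow> symmetric_mat A \<and> symmetric_mat B \<and> dim_row A = dim_row B \<and> pos_def (B - A)"

definition append_cols :: "real mat \<Rightarrow> real mat \<Rightarrow> real mat" (infixr \<open>@\<^sub>c\<close> 65) where
  "A @\<^sub>c B = four_block_mat A B (0\<^sub>m 0 (dim_col A)) (0\<^sub>m 0 (dim_col B))"

definition diag_of_vec :: "real vec \<Rightarrow> real mat" where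
  "diag_of_vec v = mat_diag (dim_vec v) (\<lambda>i. v $ i)"

definition midpoint_mat :: "real mat \<Rightarrow> real mat \<Rightarrow> real mat" where
  "midpoint_mat L U = (1/2) \<cdot>\<^sub>m (U + L)"

definition radius_mat :: "real mat \<Rightarrow> real mat \<Rightarrow> real mat" where
  "radius_mat L U = (1/2) \<cdot>\<^sub>m (U - L)"


section \<open>Feedforward networks\<close>

text \<open>Layers are numbered from \<open>1\<close> to \<open>depth N\<close>; the input dimension is \<open>width N 0\<close>, and the
  affine output map has index \<open>depth N + 1\<close>, so that the output dimension is
  \<open>width N (depth N + 1)\<close>.\<close>

record network =
  depth :: nat
  width :: "nat \<Rightarrow> nat"
  weight :: "nat \<Rightarrow> real mat"
  bias :: "nat \<Rightarrow> real vec"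
  activation :: "real \<Rightarrow> real"

abbreviation in_dim :: "network \<Rightarrow> nat" where
  "in_dim N \<equiv> width N 0"

abbreviation out_dim :: "network \<Rightarrow> nat" where
  "out_dim N \<equiv> width N (depth N + 1)"

definition well_formed_network :: "network \<Rightarrow> bool" where
  "well_formed_network N \<longleftrightarrow> 1 \<le> depth N \<and>
     (\<forall>i \<in> {1..depth N + 1}. weight N i \<in> carrier_mat (width N i) (width N (i - 1)) \<and>
                             bias N i \<in> carrier_vec (width N i))"

fun layer_out :: "network \<Rightarrow> real vec \<Rightarrow> nat \<Rightarrow> real vec" where
  "layer_out N x 0 = x"
| "layer_out N x (Suc i) =
     map_vec (activation N) (weight N (Suc i) *\<^sub>v layer_out N x i + bias N (Suc i))"

definition layer_in :: "network \<Rightarrow> real vec \<Rightarrow> nat \<Rightarrow> real vec" where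
  "layer_in N x i = weight N i *\<^sub>v layer_out N x (i - 1) + bias N i"

definition network_map :: "network \<Rightarrow> real vec \<Rightarrow> real vec" where
  "network_map N x =
     weight N (depth N + 1) *\<^sub>v layer_out N x (depth N) + bias N (depth N + 1)"

text \<open>The hidden layers stacked on top of each other: layer \<open>i\<close> occupies the index block
  \<open>layer_block N i\<close>, starting at \<open>layer_offset N i\<close>.\<close>

definition layer_offset :: "network \<Rightarrow> nat \<Rightarrow> nat" where
  "layer_offset N i = (\<Sum>k = 1..<i. width N k)"

definition layer_block :: "network \<Rightarrow> nat \<Rightarrow> nat set" where
  "layer_block N i = {layer_offset N i..<layer_offset N i + width N i}"

definition act_dim :: "network \<Rightarrow> nat" where
  "act_dim N = (\<Sum>i = 1..depth N. width N i)"

definition stack_layers :: "network \<Rightarrow> (nat \<Rightarrow> real vec) \<Rightarrow> real vec" where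
  "stack_layers N f = vec_of_list (concat (map (\<lambda>i. list_of_vec (f i)) [1..<depth N + 1]))"

definition stacked_in :: "network \<Rightarrow> real vec \<Rightarrow> real vec" where
  "stacked_in N x = stack_layers N (layer_in N x)"

definition stacked_out :: "network \<Rightarrow> real vec \<Rightarrow> real vec" where
  "stacked_out N x = stack_layers N (layer_out N x)"

definition N_vx :: "network \<Rightarrow> real mat" where
  "N_vx N = weight N 1 @\<^sub>r 0\<^sub>m (act_dim N - width N 1) (in_dim N)"

definition N_vw :: "network \<Rightarrow> real mat" where
  "N_vw N = mat (act_dim N) (act_dim N) (\<lambda>(r, c).
     \<Sum>i = 2..depth N. if r \<in> layer_block N i \<and> c \<in> layer_block N (i - 1)
       then weight N i $$ (r - layer_offset N i, c - layer_offset N (i - 1)) else 0)"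

definition N_ux :: "network \<Rightarrow> real mat" where
  "N_ux N = 0\<^sub>m (out_dim N) (in_dim N)"

definition N_uw :: "network \<Rightarrow> real mat" where
  "N_uw N = 0\<^sub>m (out_dim N) (act_dim N - width N (depth N)) @\<^sub>c weight N (depth N + 1)"

definition closed_loop ::
  "real mat \<Rightarrow> real mat \<Rightarrow> network \<Rightarrow> (nat \<Rightarrow> real vec) \<Rightarrow> bool" where
  "closed_loop A B N x \<longleftrightarrow>
     (\<forall>t. x t \<in> carrier_vec (in_dim N) \<and> x (t + 1) = A *\<^sub>v x t + B *\<^sub>v network_map N (x t))"


section \<open>The matrices of the linear matrix inequalities\<close>

definition R_V :: "network \<Rightarrow> real mat" where
  "R_V N = four_block_mat (1\<^sub>m (in_dim N)) (0\<^sub>m (in_dim N) (act_dim N)) (N_ux N) (N_uw N)"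

definition R_phi :: "network \<Rightarrow> real mat" where
  "R_phi N = four_block_mat (N_vx N) (N_vw N)
                            (0\<^sub>m (act_dim N) (in_dim N)) (1\<^sub>m (act_dim N))"

definition Psi_phi :: "network \<Rightarrow> real vec \<Rightarrow> real vec \<Rightarrow> real mat" where
  "Psi_phi N \<alpha> \<beta> = four_block_mat (diag_of_vec \<beta>) (- 1\<^sub>m (act_dim N))
                                  (- diag_of_vec \<alpha>) (1\<^sub>m (act_dim N))"

definition M_phi :: "network \<Rightarrow> real vec \<Rightarrow> real mat" where
  "M_phi N lam = four_block_mat (0\<^sub>m (act_dim N) (act_dim N)) (diag_of_vec lam)
                                (diag_of_vec lam) (0\<^sub>m (act_dim N) (act_dim N))"

definition X_mat :: "network \<Rightarrow> real vec \<Rightarrow> real vec \<Rightarrow> real vec \<Rightarrow> real mat" where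
  "X_mat N \<alpha> \<beta> lam = transpose_mat (R_phi N) * transpose_mat (Psi_phi N \<alpha> \<beta>) *
                      M_phi N lam * Psi_phi N \<alpha> \<beta> * R_phi N"

definition B_N_lower :: "network \<Rightarrow> real mat \<Rightarrow> real mat \<Rightarrow> real mat" where
  "B_N_lower N Bl Bu =
     mat (in_dim N) (act_dim N) (\<lambda>ij. INF B \<in> {Bl..Bu}. (B * N_uw N) $$ ij)"

definition B_N_upper :: "network \<Rightarrow> real mat \<Rightarrow> real mat \<Rightarrow> real mat" where
  "B_N_upper N Bl Bu =
     mat (in_dim N) (act_dim N) (\<lambda>ij. SUP B \<in> {Bl..Bu}. (B * N_uw N) $$ ij)"

definition B_tilde_0 :: "network \<Rightarrow> real mat \<Rightarrow> real mat \<Rightarrow> real mat" where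
  "B_tilde_0 N Bl Bu = midpoint_mat (B_N_lower N Bl Bu) (B_N_upper N Bl Bu)"

definition B_tilde_r :: "network \<Rightarrow> real mat \<Rightarrow> real mat \<Rightarrow> real mat" where
  "B_tilde_r N Bl Bu = radius_mat (B_N_lower N Bl Bu) (B_N_upper N Bl Bu)"

definition D_mat ::
  "network \<Rightarrow> real mat \<Rightarrow> real mat \<Rightarrow> real mat \<Rightarrow> real mat \<Rightarrow> real mat" where
  "D_mat N Al Au Bl Bu =
     transpose_mat (radius_mat Al Au @\<^sub>c B_tilde_r N Bl Bu @\<^sub>c 0\<^sub>m (in_dim N) (in_dim N))"

definition Z_mat ::
  "network \<Rightarrow> real mat \<Rightarrow> real mat \<Rightarrow> real mat \<Rightarrow> real mat \<Rightarrow> real vec \<Rightarrow> real vec \<Rightarrow>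
   real vec \<Rightarrow> real mat \<Rightarrow> real mat" where
  "Z_mat N Al Au Bl Bu \<alpha> \<beta> lam P =
     (let n = in_dim N; m = out_dim N;
          Z11 = - (transpose_mat (R_V N) * (1\<^sub>m n @\<^sub>r 0\<^sub>m m n) * P * (1\<^sub>m n @\<^sub>c 0\<^sub>m n m) * R_V N)
                + X_mat N \<alpha> \<beta> lam;
          Z21 = P * (midpoint_mat Al Au @\<^sub>c B_tilde_0 N Bl Bu)
      in four_block_mat Z11 (transpose_mat Z21) Z21 (- P))"

definition hat_dim :: "network \<Rightarrow> nat" where
  "hat_dim N = 2 * in_dim N + act_dim N"

text \<open>The doubly indexed family \<open>\<gamma>\<close> is listed row by row: position \<open>i * n + j\<close> holds \<open>\<gamma> i j\<close>.\<close>

definition V_mat :: "network \<Rightarrow> (nat \<Rightarrow> nat \<Rightarrow> real) \<Rightarrow> real mat" where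
  "V_mat N \<gamma> = mat_diag (hat_dim N * in_dim N) (\<lambda>k. \<gamma> (k div in_dim N) (k mod in_dim N))"

definition U_mat :: "network \<Rightarrow> real mat \<Rightarrow> real mat" where
  "U_mat N P = mat (hat_dim N) (hat_dim N * in_dim N) (\<lambda>(r, c).
     (0\<^sub>m (in_dim N + act_dim N) (in_dim N) @\<^sub>r P) $$ (r, c mod in_dim N))"

definition gamma_sum :: "network \<Rightarrow> real mat \<Rightarrow> (nat \<Rightarrow> nat \<Rightarrow> real) \<Rightarrow> real mat" where
  "gamma_sum N D \<gamma> = mat (hat_dim N) (hat_dim N) (\<lambda>(r, c).
     \<Sum>i < hat_dim N. \<Sum>j < in_dim N.
       \<gamma> i j * (D $$ (i, j))\<^sup>2 * (unit_vec (hat_dim N) i $ r * unit_vec (hat_dim N) i $ c))"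

text \<open>In the next definition \<open>v_star\<close> is the stacked vector, whose first block is its part
  belonging to layer \<open>1\<close>.\<close>

definition cond_N :: "network \<Rightarrow> real vec \<Rightarrow> real vec \<Rightarrow> real mat \<Rightarrow> bool" where
  "cond_N N v_star v1_bar P \<longleftrightarrow>
     (\<forall>i < width N 1.
        let w = mat_of_row (row (weight N 1) i) in
        pos_semidef (four_block_mat
          (mat 1 1 (\<lambda>_. (v1_bar $ i - vec_first v_star (width N 1) $ i)\<^sup>2)) w
          (transpose_mat w) P))"


section \<open>The three conditions\<close>

definition LMI_I ::
  "network \<Rightarrow> real mat \<Rightarrow> real mat \<Rightarrow> real mat \<Rightarrow> real mat \<Rightarrow> real vec \<Rightarrow> real vec \<Rightarrow>
   real vec \<Rightarrow> real vec \<Rightarrow> bool" where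
  "LMI_I N Al Au Bl Bu \<alpha> \<beta> v_star v1_bar \<longleftrightarrow>
     (let n = in_dim N; nh = hat_dim N; D = D_mat N Al Au Bl Bu; Z = Z_mat N Al Au Bl Bu \<alpha> \<beta> in
      \<exists>P lam \<gamma>. P \<in> carrier_mat n n \<and> pos_def P \<and>
        lam \<in> carrier_vec (act_dim N) \<and> 0\<^sub>v (act_dim N) \<le> lam \<and>
        (\<forall>i < nh. \<forall>j < n. 0 < \<gamma> i j) \<and> cond_N N v_star v1_bar P \<and>
        four_block_mat (Z lam P + gamma_sum N D \<gamma>) (U_mat N P)
                       (transpose_mat (U_mat N P)) (- V_mat N \<gamma>)
          \<prec>\<^sub>d 0\<^sub>m (nh + nh * n) (nh + nh * n))"

definition LMI_II ::
  "network \<Rightarrow> real mat \<Rightarrow> real mat \<Rightarrow> real mat \<Rightarrow> real mat \<Rightarrow> real vec \<Rightarrow> real vec \<Rightarrow>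
   real vec \<Rightarrow> real vec \<Rightarrow> bool" where
  "LMI_II N Al Au Bl Bu \<alpha> \<beta> v_star v1_bar \<longleftrightarrow>
     (let n = in_dim N; nh = hat_dim N; D = D_mat N Al Au Bl Bu; Z = Z_mat N Al Au Bl Bu \<alpha> \<beta> in
      \<exists>P lam T S. P \<in> carrier_mat n n \<and> pos_def P \<and>
        lam \<in> carrier_vec (act_dim N) \<and> 0\<^sub>v (act_dim N) \<le> lam \<and>
        T \<in> carrier_mat nh nh \<and> diagonal_mat T \<and> S \<in> carrier_mat n n \<and> diagonal_mat S \<and>
        cond_N N v_star v1_bar P \<and> D * S * transpose_mat D \<prec>\<^sub>d T \<and>
        (let E = 0\<^sub>m n (n + act_dim N) @\<^sub>c P in
         four_block_mat (Z lam P + T) (transpose_mat E) E (- S) \<prec>\<^sub>d 0\<^sub>m (nh + n) (nh + n)))"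

definition LMI_III ::
  "network \<Rightarrow> real mat \<Rightarrow> real mat \<Rightarrow> real mat \<Rightarrow> real mat \<Rightarrow> real vec \<Rightarrow> real vec \<Rightarrow>
   real vec \<Rightarrow> real vec \<Rightarrow> bool" where
  "LMI_III N Al Au Bl Bu \<alpha> \<beta> v_star v1_bar \<longleftrightarrow>
     (let n = in_dim N; nh = hat_dim N; D = D_mat N Al Au Bl Bu; Z = Z_mat N Al Au Bl Bu \<alpha> \<beta> in
      \<exists>P lam \<gamma> Y. P \<in> carrier_mat n n \<and> pos_def P \<and>
        lam \<in> carrier_vec (act_dim N) \<and> 0\<^sub>v (act_dim N) \<le> lam \<and>
        (\<forall>i < nh. \<forall>j < n. 0 < \<gamma> i j) \<and>
        Y \<in> carrier_mat nh nh \<and> symmetric_mat Y \<and>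
        cond_N N v_star v1_bar P \<and> Y \<prec>\<^sub>d - Z lam P \<and>
        0\<^sub>m (nh + nh * n) (nh + nh * n) \<prec>\<^sub>d
          four_block_mat (Y - gamma_sum N D \<gamma>) (U_mat N P)
                         (transpose_mat (U_mat N P)) (V_mat N \<gamma>))"

end

theory Submission
  imports Defs "Jordan_Normal_Form.Determinant" "HOL-Analysis.Function_Topology"
begin

text \<open>
After taking Schur complements all three conditions have the same shape: for suitable \<open>P\<close> and
\<open>\<lambda>\<close>, and with \<open>E = [0 P]\<close>, the matrix \<open>Z + diag t + E\<^sup>T diag g E\<close> is negative definite (\<open>reduced_lmi\<close>).
In (LMI-I) and (LMI-III) the weights come from multipliers, \<open>t\<^sub>i = \<Sum>\<^sub>j \<gamma>\<^sub>i\<^sub>j D\<^sub>i\<^sub>j\<^sup>2\<close> and \<open>g\<^sub>j = \<Sum>\<^sub>i 1 / \<gamma>\<^sub>i\<^sub>j\<close>;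
the second formula holds because the blocks of \<open>U\<close> are equal (\<open>replicate_block_sum\<close>). In (LMI-II)
they come from the diagonal matrices, \<open>g\<^sub>j = 1 / s\<^sub>j\<close>, subject to \<open>D S D\<^sup>T \<prec> T\<close>.

Strict definiteness is stable under small perturbations, by compactness of the sphere
(\<open>quadratic_form_slack\<close>, \<open>reduced_lmi_slack\<close>). This makes (LMI-III) equivalent to (LMI-I): the
matrix \<open>Y = - (Z + \<epsilon> I)\<close> can be inserted (\<open>reduced_lmi_iff_majorant\<close>).

For multipliers \<open>\<gamma>\<close> the Cauchy-Schwarz inequality yields \<open>D S D\<^sup>T \<preceq> diag t\<close> with \<open>s\<^sub>j = 1 / g\<^sub>j\<close>, and a
perturbation of \<open>t\<close> makes this strict; so (LMI-I) implies (LMI-II). The converse uses that \<open>D\<close> has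
nonnegative entries. Then \<open>T - D S D\<^sup>T\<close> is a positive definite matrix with nonpositive
off-diagonal entries, that is, an M-matrix, and there is a positive vector \<open>y\<close> with
\<open>D S D\<^sup>T y < T y\<close> entrywise (\<open>pos_definite_Z_matrix_positive_vector\<close>). The multipliers
\<open>\<gamma>\<^sub>i\<^sub>j = s\<^sub>j (D\<^sup>T y)\<^sub>j / (D\<^sub>i\<^sub>j y\<^sub>i)\<close>, corrected where \<open>D\<^sub>i\<^sub>j\<close> vanishes, then achieve
\<open>\<Sum>\<^sub>j \<gamma>\<^sub>i\<^sub>j D\<^sub>i\<^sub>j\<^sup>2 \<le> t\<^sub>i\<close> and \<open>\<Sum>\<^sub>i 1 / \<gamma>\<^sub>i\<^sub>j \<le> 1 / s\<^sub>j + \<epsilon>\<close> (\<open>exists_multipliers\<close>).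
\<close>

section \<open>Quadratic forms and compactness\<close>

lemma quadratic_form_sum:
  fixes A :: "real mat"
  assumes "A \<in> carrier_mat p p" "x \<in> carrier_vec p"
  shows "x \<bullet> (A *\<^sub>v x) = (\<Sum>i<p. \<Sum>j<p. A $$ (i, j) * x $ i * x $ j)"
  using assms
  by (auto simp: scalar_prod_def row_def sum_distrib_left atLeast0LessThan ac_simps intro!: sum.cong)

lemma quadratic_form_smult:
  fixes A :: "real mat"
  assumes "A \<in> carrier_mat p p" "x \<in> carrier_vec p"
  shows "(r \<cdot>\<^sub>v x) \<bullet> (A *\<^sub>v (r \<cdot>\<^sub>v x)) = r\<^sup>2 * (x \<bullet> (A *\<^sub>v x))"
  using assms by (simp add: quadratic_form_sum sum_distrib_left power2_eq_square ac_simps)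

lemma quadratic_form_uminus:
  fixes A :: "real mat"
  assumes "A \<in> carrier_mat p p" "x \<in> carrier_vec p"
  shows "x \<bullet> (- A *\<^sub>v x) = - (x \<bullet> (A *\<^sub>v x))"
  using assms by (simp add: quadratic_form_sum sum_negf)

lemma quadratic_form_add:
  fixes A B :: "real mat"
  assumes "A \<in> carrier_mat p p" "B \<in> carrier_mat p p" "x \<in> carrier_vec p"
  shows "x \<bullet> ((A + B) *\<^sub>v x) = x \<bullet> (A *\<^sub>v x) + x \<bullet> (B *\<^sub>v x)"
  using assms by (simp add: add_mult_distrib_mat_vec[of _ p p] scalar_prod_add_distrib[of _ p])

lemma quadratic_form_minus:
  fixes A B :: "real mat"
  assumes "A \<in> carrier_mat p p" "B \<in> carrier_mat p p" "x \<in> carrier_vec p"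
  shows "x \<bullet> ((A - B) *\<^sub>v x) = x \<bullet> (A *\<^sub>v x) - x \<bullet> (B *\<^sub>v x)"
  using assms by (simp add: minus_mult_distrib_mat_vec[of _ p p] scalar_prod_minus_distrib[of _ p])

lemma mult_mat_diag_vec:
  fixes x :: "real vec"
  assumes "x \<in> carrier_vec p"
  shows "mat_diag p t *\<^sub>v x = vec p (\<lambda>i. t i * x $ i)"
proof (rule eq_vecI)
  fix i assume "i < dim_vec (vec p (\<lambda>i. t i * (x $ i)))"
  then have i: "i < p" by simp
  have "(mat_diag p t *\<^sub>v x) $ i = (\<Sum>j\<in>{0..<p}. if j = i then t i * x $ i else 0)"
    using i assms unfolding mat_diag_def mult_mat_vec_def scalar_prod_def row_def
    by (auto intro!: sum.cong simp del: sum.delta)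
  then show "(mat_diag p t *\<^sub>v x) $ i = vec p (\<lambda>i. t i * (x $ i)) $ i" using i by simp
qed (use assms in \<open>auto simp: mat_diag_def\<close>)

lemma quadratic_form_mat_diag:
  fixes x :: "real vec"
  assumes "x \<in> carrier_vec p"
  shows "x \<bullet> (mat_diag p t *\<^sub>v x) = (\<Sum>i<p. t i * (x $ i)\<^sup>2)"
  using assms unfolding mult_mat_diag_vec[OF assms]
  by (auto simp: scalar_prod_def atLeast0LessThan power2_eq_square ac_simps intro!: sum.cong)

lemma symmetric_mat_iff:
  assumes "A \<in> carrier_mat p p"
  shows "symmetric_mat A \<longleftrightarrow> (\<forall>i<p. \<forall>j<p. A $$ (i, j) = A $$ (j, i))"
  using assms unfolding symmetric_mat_def by (auto simp: mat_eq_iff)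

lemma symmetric_mat_diag: "symmetric_mat (mat_diag p t)"
  unfolding symmetric_mat_def by (auto simp: mat_diag_def intro!: eq_matI)

lemma quadratic_form_gram:
  fixes F :: "real mat"
  assumes F: "F \<in> carrier_mat p q" and x: "x \<in> carrier_vec p"
  shows "x \<bullet> ((F * mat_diag q g * transpose_mat F) *\<^sub>v x) = (\<Sum>k<q. g k * (col F k \<bullet> x)\<^sup>2)"
proof -
  have tx: "transpose_mat F *\<^sub>v x = vec q (\<lambda>k. col F k \<bullet> x)"
    using F by (intro eq_vecI) auto
  have "(F * mat_diag q g * transpose_mat F) *\<^sub>v x
      = F *\<^sub>v (mat_diag q g *\<^sub>v (transpose_mat F *\<^sub>v x))"
    using F x by (subst assoc_mult_mat_vec[of _ p q _ p], auto intro: mult_carrier_mat assoc_mult_mat_vec[of _ p q _ q])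
  also have "x \<bullet> \<dots> = (transpose_mat F *\<^sub>v x) \<bullet> (mat_diag q g *\<^sub>v (transpose_mat F *\<^sub>v x))"
    using F by (intro transpose_vec_mult_scalar[OF F _ x, symmetric] mult_mat_vec_carrier[OF mat_diag_dim]
        mult_mat_vec_carrier[OF _ x]) auto
  also have "\<dots> = (\<Sum>k<q. g k * (col F k \<bullet> x)\<^sup>2)"
    unfolding tx by (subst quadratic_form_mat_diag) auto
  finally show ?thesis .
qed

lemma symmetric_gram:
  fixes F :: "real mat"
  assumes F: "F \<in> carrier_mat p q"
  shows "symmetric_mat (F * mat_diag q g * transpose_mat F)"
proof -
  have "transpose_mat (F * mat_diag q g * transpose_mat F)
      = F * (mat_diag q g * transpose_mat F)"
    using F symmetric_mat_diag[of q g] unfolding symmetric_mat_def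
    by (subst transpose_mult[of _ p q _ p], auto intro: mult_carrier_mat simp: transpose_mult[of F p q "mat_diag q g" q])
  also have "\<dots> = F * mat_diag q g * transpose_mat F"
    using F by (intro assoc_mult_mat[symmetric]) auto
  finally show ?thesis using F unfolding symmetric_mat_def by simp
qed

lemma compact_unit_sphere_functions:
  "compact {x :: nat \<Rightarrow> real. (\<forall>i\<ge>p. x i = 0) \<and> (\<Sum>i<p. (x i)\<^sup>2) = 1}" (is "compact ?K")
proof -
  let ?box = "PiE UNIV (\<lambda>i. if i < p then {-1..1} else {0}) :: (nat \<Rightarrow> real) set"
  have "compactin (product_topology (\<lambda>i. euclidean) UNIV) ?box"
    unfolding compactin_PiE by auto
  then have "compact ?box"
    by (simp add: euclidean_product_topology)
  moreover have "closed {x :: nat \<Rightarrow> real. (\<Sum>i<p. (x i)\<^sup>2) = 1}"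
    by (intro closed_Collect_eq continuous_intros continuous_on_product_coordinates)
  ultimately have "compact (?box \<inter> {x. (\<Sum>i<p. (x i)\<^sup>2) = 1})"
    by (rule compact_Int_closed)
  moreover have "?K = ?box \<inter> {x. (\<Sum>i<p. (x i)\<^sup>2) = 1}"
  proof (intro subset_antisym subsetI)
    fix x assume x: "x \<in> ?K"
    have "\<bar>x i\<bar> \<le> 1" if "i < p" for i
    proof -
      have "(x i)\<^sup>2 \<le> (\<Sum>i<p. (x i)\<^sup>2)" using that by (intro member_le_sum) auto
      then show ?thesis using x by (simp add: abs_square_le_1)
    qed
    then have "x i \<in> (if i < p then {-1..1} else {0})" for i
      using x by (auto simp: abs_le_iff minus_le_iff)
    then have "x \<in> ?box" by (simp add: PiE_def Pi_def)
    then show "x \<in> ?box \<inter> {x. (\<Sum>i<p. (x i)\<^sup>2) = 1}" using x by simp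
  next
    fix x assume x: "x \<in> ?box \<inter> {x. (\<Sum>i<p. (x i)\<^sup>2) = 1}"
    then have "x i \<in> (if i < p then {-1..1} else {0})" for i by (simp add: PiE_def Pi_def)
    then have "x i = 0" if "i \<ge> p" for i using that by (metis leD singletonD)
    then show "x \<in> ?K" using x by auto
  qed
  ultimately show ?thesis by simp
qed

text \<open>A strict inequality between quadratic forms leaves room for a small multiple of any other form:
both forms attain their extrema on the unit sphere, and homogeneity of degree two carries the
estimate from the sphere to all of space. The sphere is taken in the space of functions on the
naturals that vanish from \<open>p\<close> on, where compactness comes from Tychonoff's theorem.\<close>
lemma quadratic_form_slack:
  fixes A H :: "real mat"
  assumes A: "A \<in> carrier_mat p p" and H: "H \<in> carrier_mat p p"
    and pos: "\<And>x. x \<in> carrier_vec p \<Longrightarrow> x \<noteq> 0\<^sub>v p \<Longrightarrow> 0 < x \<bullet> (A *\<^sub>v x)"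
  shows "\<exists>\<epsilon>>0. \<forall>x \<in> carrier_vec p. x \<noteq> 0\<^sub>v p \<longrightarrow> \<epsilon> * (x \<bullet> (H *\<^sub>v x)) < x \<bullet> (A *\<^sub>v x)"
proof (cases "p = 0")
  case True
  then have z: "x = 0\<^sub>v p" if "x \<in> carrier_vec p" for x :: "real vec" using that by auto
  show ?thesis by (intro exI[of _ "1 :: real"] conjI ballI impI zero_less_one) (use z in auto)
next
  case False
  define K where "K = {x :: nat \<Rightarrow> real. (\<forall>i\<ge>p. x i = 0) \<and> (\<Sum>i<p. (x i)\<^sup>2) = 1}"
  let ?q = "\<lambda>B x. \<Sum>i<p. \<Sum>j<p. B $$ (i, j) * x i * x j"
  have "(\<lambda>i. if i = 0 then 1 else 0) \<in> K"
  proof -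
    have "(\<Sum>i<p. (if i = 0 then 1 else 0 :: real)\<^sup>2) = (\<Sum>i<p. if i = 0 then 1 else 0)"
      by (intro sum.cong) auto
    then show ?thesis using False by (auto simp: K_def)
  qed
  then have ne: "K \<noteq> {}" by blast
  have compact: "compact K" unfolding K_def by (rule compact_unit_sphere_functions)
  have cont: "continuous_on K (?q B)" for B
    by (intro continuous_intros continuous_on_subset[OF continuous_on_product_coordinates]) auto
  obtain a where a: "a \<in> K" "\<And>x. x \<in> K \<Longrightarrow> ?q A a \<le> ?q A x"
    using continuous_attains_inf[OF compact ne cont] by blast
  obtain b where b: "\<And>x. x \<in> K \<Longrightarrow> ?q H x \<le> ?q H b"
    using continuous_attains_sup[OF compact ne cont] by blast
  define m where "m = ?q A a"
  define M where "M = ?q H b"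
  have "m > 0"
  proof -
    have "vec p a \<noteq> 0\<^sub>v p"
    proof
      assume z: "vec p a = 0\<^sub>v p"
      have "a i = 0" if "i < p" for i
        using that arg_cong[OF z, of "\<lambda>v. v $ i"] by simp
      then show False using a(1) by (simp add: K_def)
    qed
    then have "0 < vec p a \<bullet> (A *\<^sub>v vec p a)" by (intro pos) auto
    then show ?thesis unfolding m_def using A by (subst (asm) quadratic_form_sum) auto
  qed
  define \<epsilon> where "\<epsilon> = m / (\<bar>M\<bar> + 1)"
  have "\<epsilon> > 0" unfolding \<epsilon>_def using \<open>m > 0\<close> by (intro divide_pos_pos) auto
  have "\<epsilon> * M < m"
  proof -
    have "m * M < m * (\<bar>M\<bar> + 1)" using \<open>m > 0\<close> by (intro mult_strict_left_mono) auto
    then show ?thesis unfolding \<epsilon>_def by (simp add: field_simps)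
  qed
  have "\<epsilon> * (x \<bullet> (H *\<^sub>v x)) < x \<bullet> (A *\<^sub>v x)" if x: "x \<in> carrier_vec p" "x \<noteq> 0\<^sub>v p" for x
  proof -
    define r where "r = sqrt (\<Sum>i<p. (x $ i)\<^sup>2)"
    obtain i where "i < p" "x $ i \<noteq> 0"
      using x by (metis eq_vecI index_zero_vec carrier_vecD)
    then have "(\<Sum>i<p. (x $ i)\<^sup>2) > 0" by (intro sum_pos2[of _ i]) auto
    then have r: "r > 0" "r\<^sup>2 = (\<Sum>i<p. (x $ i)\<^sup>2)" unfolding r_def by auto
    define u where "u = (\<lambda>i. if i < p then x $ i / r else 0)"
    have "(\<Sum>i<p. (u i)\<^sup>2) = (\<Sum>i<p. (x $ i)\<^sup>2) / r\<^sup>2"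
      unfolding sum_divide_distrib by (intro sum.cong) (auto simp: u_def power_divide)
    then have u: "u \<in> K" using r by (auto simp: u_def K_def)
    have xu: "x = r \<cdot>\<^sub>v vec p u" using x r by (intro eq_vecI) (auto simp: u_def)
    have q: "x \<bullet> (B *\<^sub>v x) = r\<^sup>2 * ?q B u" if B: "B \<in> carrier_mat p p" for B
      unfolding xu by (subst quadratic_form_smult[OF B]) (auto simp: quadratic_form_sum[OF B])
    have "\<epsilon> * ?q H u \<le> \<epsilon> * M" using b[OF u] \<open>\<epsilon> > 0\<close> unfolding M_def by (intro mult_left_mono) auto
    also have "\<dots> < m" by fact
    also have "m \<le> ?q A u" unfolding m_def by (rule a(2)[OF u])
    finally have "r\<^sup>2 * (\<epsilon> * ?q H u) < r\<^sup>2 * ?q A u" using r(1) by (intro mult_strict_left_mono) simp_all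
    then show ?thesis unfolding q[OF A] q[OF H] by (simp add: ac_simps)
  qed
  then show ?thesis using \<open>\<epsilon> > 0\<close> by blast
qed

section \<open>Schur complements and M-matrices\<close>

lemma quadratic_form_four_block:
  fixes A B :: "real mat"
  assumes A: "A \<in> carrier_mat p p" and B: "B \<in> carrier_mat p q"
    and x: "x \<in> carrier_vec p" and z: "z \<in> carrier_vec q"
  shows "(x @\<^sub>v z) \<bullet> (four_block_mat A B (transpose_mat B) (mat_diag q c) *\<^sub>v (x @\<^sub>v z))
    = x \<bullet> (A *\<^sub>v x) + (\<Sum>k<q. 2 * z $ k * (col B k \<bullet> x) + c k * (z $ k)\<^sup>2)"
proof -
  have tx: "transpose_mat B *\<^sub>v x = vec q (\<lambda>k. col B k \<bullet> x)"
    using B by (intro eq_vecI) auto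
  have dz: "mat_diag q c *\<^sub>v z \<in> carrier_vec q" by (rule mult_mat_vec_carrier[OF mat_diag_dim z])
  have bz: "B *\<^sub>v z \<in> carrier_vec p" "A *\<^sub>v x \<in> carrier_vec p" "transpose_mat B *\<^sub>v x \<in> carrier_vec q"
    using A B x z by (auto intro!: mult_mat_vec_carrier[of _ p p] mult_mat_vec_carrier[of _ p q]
        mult_mat_vec_carrier[of _ q p])
  have sum: "(transpose_mat B *\<^sub>v x) \<bullet> z = (\<Sum>k<q. z $ k * (col B k \<bullet> x))"
    unfolding tx scalar_prod_def[of _ z] using z
    by (simp add: atLeast0LessThan mult.commute)
  have xBz: "x \<bullet> (B *\<^sub>v z) = (transpose_mat B *\<^sub>v x) \<bullet> z"
    by (rule transpose_vec_mult_scalar[OF B z x, symmetric])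
  have "(x @\<^sub>v z) \<bullet> (four_block_mat A B (transpose_mat B) (mat_diag q c) *\<^sub>v (x @\<^sub>v z))
      = x \<bullet> (A *\<^sub>v x + B *\<^sub>v z) + z \<bullet> (transpose_mat B *\<^sub>v x + mat_diag q c *\<^sub>v z)"
    using B bz dz
    by (subst four_block_mat_mult_vec[OF A B _ mat_diag_dim x z])
       (auto intro!: scalar_prod_append[OF x z])
  also have "\<dots> = x \<bullet> (A *\<^sub>v x) + x \<bullet> (B *\<^sub>v z) + (z \<bullet> (transpose_mat B *\<^sub>v x) + z \<bullet> (mat_diag q c *\<^sub>v z))"
    using scalar_prod_add_distrib[OF x bz(2,1)] scalar_prod_add_distrib[OF z bz(3) dz] by simp
  also have "z \<bullet> (transpose_mat B *\<^sub>v x) = (transpose_mat B *\<^sub>v x) \<bullet> z"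
    by (rule comm_scalar_prod[OF z bz(3)])
  finally show ?thesis
    unfolding xBz sum quadratic_form_mat_diag[OF z]
    by (simp add: sum.distrib sum_distrib_left algebra_simps)
qed

text \<open>For fixed \<open>x\<close> the form is a sum of separate quadratic functions of the entries of the second
block, \<open>2 z\<^sub>k b\<^sub>k + c\<^sub>k z\<^sub>k\<^sup>2\<close> with \<open>b\<^sub>k = col B k \<bullet> x\<close>. Completing squares gives the minimum
\<open>- b\<^sub>k\<^sup>2 / c\<^sub>k\<close>, attained at \<open>z\<^sub>k = - b\<^sub>k / c\<^sub>k\<close>.\<close>
lemma schur_complement_diag:
  fixes A B :: "real mat"
  assumes A: "A \<in> carrier_mat p p" and B: "B \<in> carrier_mat p q"
  shows "pos_def (four_block_mat A B (transpose_mat B) (mat_diag q c)) \<longleftrightarrow>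
    symmetric_mat A \<and> (\<forall>k<q. 0 < c k) \<and>
    (\<forall>x \<in> carrier_vec p. x \<noteq> 0\<^sub>v p \<longrightarrow> (\<Sum>k<q. (col B k \<bullet> x)\<^sup>2 / c k) < x \<bullet> (A *\<^sub>v x))"
    (is "pos_def ?M \<longleftrightarrow> _")
proof -
  let ?b = "\<lambda>x k. col B k \<bullet> x"
  let ?form = "\<lambda>x z. x \<bullet> (A *\<^sub>v x) + (\<Sum>k<q. 2 * z $ k * ?b x k + c k * (z $ k)\<^sup>2)"
  have M: "?M \<in> carrier_mat (p + q) (p + q)" using A by auto
  have "symmetric_mat ?M \<longleftrightarrow> symmetric_mat A"
  proof
    assume "symmetric_mat ?M"
    then have "?M $$ (i, j) = ?M $$ (j, i)" if "i < p + q" "j < p + q" for i j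
      using symmetric_mat_iff[OF M] that by blast
    then have "A $$ (i, j) = A $$ (j, i)" if "i < p" "j < p" for i j
      using that A B by (metis (no_types, lifting) carrier_matD index_mat_four_block(1) trans_less_add1)
    then show "symmetric_mat A" using symmetric_mat_iff[OF A] by blast
  next
    assume "symmetric_mat A"
    then show "symmetric_mat ?M"
      using A B unfolding symmetric_mat_iff[OF A] symmetric_mat_iff[OF M]
      by (auto simp: mat_diag_def)
  qed
  moreover have "(\<forall>v \<in> carrier_vec (p + q). v \<noteq> 0\<^sub>v (p + q) \<longrightarrow> 0 < v \<bullet> (?M *\<^sub>v v)) \<longleftrightarrow>
      (\<forall>x \<in> carrier_vec p. \<forall>z \<in> carrier_vec q. (x \<noteq> 0\<^sub>v p \<or> z \<noteq> 0\<^sub>v q) \<longrightarrow> 0 < ?form x z)"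
  proof -
    have zero: "(x @\<^sub>v z = 0\<^sub>v (p + q)) \<longleftrightarrow> x = 0\<^sub>v p \<and> z = 0\<^sub>v q"
      if "x \<in> carrier_vec p" "z \<in> carrier_vec q" for x z :: "real vec"
    proof -
      have "0\<^sub>v (p + q) = 0\<^sub>v p @\<^sub>v (0\<^sub>v q :: real vec)" by (intro eq_vecI) auto
      then show ?thesis using that by (simp add: append_vec_eq[of _ p])
    qed
    show ?thesis unfolding all_vec_append
      by (intro ball_cong refl) (simp add: zero quadratic_form_four_block[OF A B] del: append_vec_eq)
  qed
  ultimately have iff: "pos_def ?M \<longleftrightarrow> symmetric_mat A \<and>
      (\<forall>x \<in> carrier_vec p. \<forall>z \<in> carrier_vec q. (x \<noteq> 0\<^sub>v p \<or> z \<noteq> 0\<^sub>v q) \<longrightarrow> 0 < ?form x z)"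
    unfolding pos_def_def carrier_matD(1)[OF M] by (simp only:)
  have form0: "?form (0\<^sub>v p) z = (\<Sum>k<q. c k * (z $ k)\<^sup>2)" for z
    using A B by (auto intro!: sum.cong scalar_prod_left_zero mult_mat_vec_carrier[of _ p p])
  show ?thesis unfolding iff
  proof (intro conj_cong refl iffI conjI allI impI ballI)
    fix k assume pos: "\<forall>x\<in>carrier_vec p. \<forall>z\<in>carrier_vec q.
      (x \<noteq> 0\<^sub>v p \<or> z \<noteq> 0\<^sub>v q) \<longrightarrow> 0 < ?form x z" and k: "k < q"
    \<comment> \<open>On the unit vectors of the second block the form takes the diagonal entries as values.\<close>
    have "unit_vec q k \<noteq> (0\<^sub>v q :: real vec)" using k by simp
    then have "0 < ?form (0\<^sub>v p) (unit_vec q k)"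
      by (intro pos[rule_format]) auto
    also have "\<dots> = (\<Sum>j<q. if j = k then c k else 0)"
      unfolding form0 using k by (intro sum.cong) auto
    finally show "0 < c k" using k by simp
  next
    fix x :: "real vec" assume pos: "\<forall>x\<in>carrier_vec p. \<forall>z\<in>carrier_vec q.
      (x \<noteq> 0\<^sub>v p \<or> z \<noteq> 0\<^sub>v q) \<longrightarrow> 0 < ?form x z" and x: "x \<in> carrier_vec p" "x \<noteq> 0\<^sub>v p"
    \<comment> \<open>This vector minimises the form over the second block.\<close>
    define z where "z = vec q (\<lambda>k. - ?b x k / c k)"
    have "0 < ?form x z" using x by (intro pos[rule_format]) (auto simp: z_def)
    also have "\<dots> = x \<bullet> (A *\<^sub>v x) + (\<Sum>k<q. - ((?b x k)\<^sup>2 / c k))"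
      by (intro arg_cong2[where f = "(+)"] sum.cong refl) (auto simp: z_def power2_eq_square field_simps)
    finally show "(\<Sum>k<q. (?b x k)\<^sup>2 / c k) < x \<bullet> (A *\<^sub>v x)" by (simp add: sum_negf)
  next
    fix x z :: "real vec"
    assume asm: "(\<forall>k<q. 0 < c k) \<and> (\<forall>x\<in>carrier_vec p. x \<noteq> 0\<^sub>v p \<longrightarrow>
        (\<Sum>k<q. (?b x k)\<^sup>2 / c k) < x \<bullet> (A *\<^sub>v x))"
      and xz: "x \<in> carrier_vec p" "z \<in> carrier_vec q" "x \<noteq> 0\<^sub>v p \<or> z \<noteq> 0\<^sub>v q"
    show "0 < ?form x z"
    proof (cases "x = 0\<^sub>v p")
      case True
      then have "z \<noteq> 0\<^sub>v q" using xz by simp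
      then obtain k where k: "k < q" "z $ k \<noteq> 0"
        using xz by (metis eq_vecI index_zero_vec carrier_vecD)
      have "0 < (\<Sum>k<q. c k * (z $ k)\<^sup>2)"
        using asm k by (intro sum_pos2[of _ k]) (auto simp: less_imp_le)
      then show ?thesis unfolding True form0 .
    next
      case False
      have "(\<Sum>k<q. - ((?b x k)\<^sup>2 / c k)) \<le> (\<Sum>k<q. 2 * z $ k * ?b x k + c k * (z $ k)\<^sup>2)"
      proof (intro sum_mono)
        fix k assume "k \<in> {..<q}"
        then have c: "0 < c k" using asm by simp
        have "0 \<le> c k * (z $ k + ?b x k / c k)\<^sup>2" using c by simp
        also have "\<dots> = c k * (z $ k)\<^sup>2 + 2 * z $ k * ?b x k + (?b x k)\<^sup>2 / c k"
          using c by (simp add: power2_eq_square field_simps)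
        finally show "- ((?b x k)\<^sup>2 / c k) \<le> 2 * z $ k * ?b x k + c k * (z $ k)\<^sup>2" by simp
      qed
      moreover have "(\<Sum>k<q. (?b x k)\<^sup>2 / c k) < x \<bullet> (A *\<^sub>v x)" using asm xz False by blast
      ultimately show ?thesis by (simp add: sum_negf)
    qed
  qed
qed

text \<open>The M-matrix property. The witness solves \<open>M y = 1\<close>. If \<open>w\<close> is the negative part of \<open>y\<close>, then
\<open>w\<^sub>i M\<^sub>i\<^sub>k y\<^sub>k \<le> - w\<^sub>i M\<^sub>i\<^sub>k w\<^sub>k\<close> for all \<open>i\<close> and \<open>k\<close>: on the diagonal because \<open>w\<^sub>i y\<^sub>i = - w\<^sub>i\<^sup>2\<close>, off the
diagonal because \<open>M\<^sub>i\<^sub>k \<le> 0\<close> and \<open>y\<^sub>k \<ge> - w\<^sub>k\<close>. Hence \<open>w\<^sup>T M w \<le> - w\<^sup>T M y \<le> 0\<close> and \<open>w = 0\<close>. An entry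
\<open>y\<^sub>i = 0\<close> would then make the \<open>i\<close>-th entry of \<open>M y\<close> nonpositive.\<close>
lemma pos_definite_Z_matrix_positive_vector:
  fixes M :: "real mat"
  assumes M: "M \<in> carrier_mat p p"
    and pos: "\<And>x. x \<in> carrier_vec p \<Longrightarrow> x \<noteq> 0\<^sub>v p \<Longrightarrow> 0 < x \<bullet> (M *\<^sub>v x)"
    and off: "\<And>i k. i < p \<Longrightarrow> k < p \<Longrightarrow> i \<noteq> k \<Longrightarrow> M $$ (i, k) \<le> 0"
  shows "\<exists>y :: nat \<Rightarrow> real. (\<forall>i<p. 0 < y i) \<and> (\<forall>i<p. 0 < (\<Sum>k<p. M $$ (i, k) * y k))"
proof -
  have "det M \<noteq> 0"
  proof
    assume "det M = 0"
    then obtain v where v: "v \<in> carrier_vec p" "v \<noteq> 0\<^sub>v p" "M *\<^sub>v v = 0\<^sub>v p"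
      using det_0_iff_vec_prod_zero[OF M] by blast
    then show False using pos[OF v(1,2)] by simp
  qed
  then obtain N where N: "N \<in> carrier_mat p p" "M * N = 1\<^sub>m p"
    using det_non_zero_imp_unit[OF M, of "()"] unfolding Units_def ring_mat_def by auto
  define y where "y = (\<lambda>i. (N *\<^sub>v vec p (\<lambda>_. 1)) $ i)"
  have My: "(\<Sum>k<p. M $$ (i, k) * y k) = 1" if i: "i < p" for i
  proof -
    have "M *\<^sub>v (N *\<^sub>v vec p (\<lambda>_. 1)) = (M * N) *\<^sub>v vec p (\<lambda>_. 1)"
      by (rule assoc_mult_mat_vec[symmetric, OF M N(1)]) simp
    also have "\<dots> = vec p (\<lambda>_. 1)" unfolding N(2) by simp
    finally have "(M *\<^sub>v (N *\<^sub>v vec p (\<lambda>_. 1))) $ i = 1" using i by simp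
    then show ?thesis using i M N(1)
      by (simp add: y_def mult_mat_vec_def scalar_prod_def row_def atLeast0LessThan)
  qed
  define w where "w = (\<lambda>i. max 0 (- y i))"
  have "vec p w = 0\<^sub>v p"
  proof (rule ccontr)
    assume "vec p w \<noteq> 0\<^sub>v p"
    then have "0 < vec p w \<bullet> (M *\<^sub>v vec p w)" by (intro pos) auto
    also have "\<dots> = (\<Sum>i<p. \<Sum>k<p. M $$ (i, k) * w i * w k)"
      by (subst quadratic_form_sum[OF M]) auto
    also have "\<dots> \<le> (\<Sum>i<p. \<Sum>k<p. - (w i * (M $$ (i, k) * y k)))"
    proof (intro sum_mono)
      fix i k assume ik: "i \<in> {..<p}" "k \<in> {..<p}"
      show "M $$ (i, k) * w i * w k \<le> - (w i * (M $$ (i, k) * y k))"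
      proof (cases "i = k")
        case True
        have "w i * w i = - (w i * y i)" by (auto simp: w_def max_def)
        then show ?thesis using True by (simp add: mult.assoc mult.left_commute)
      next
        case False
        then have "M $$ (i, k) * w i \<le> 0"
          using off[of i k] ik by (intro mult_nonpos_nonneg) (auto simp: w_def)
        then have "(M $$ (i, k) * w i) * w k \<le> (M $$ (i, k) * w i) * (- y k)"
          by (intro mult_left_mono_neg) (auto simp: w_def)
        then show ?thesis by (simp add: ac_simps)
      qed
    qed
    also have "\<dots> = - (\<Sum>i<p. w i)"
      by (simp add: sum_negf sum_distrib_left[symmetric] My)
    also have "\<dots> \<le> 0" by (auto intro!: sum_nonneg simp: w_def)
    finally show False by simp
  qed
  then have "w i = 0" if "i < p" for i using that by (metis index_vec index_zero_vec(1))
  then have y0: "0 \<le> y i" if "i < p" for i using that unfolding w_def by (metis max.cobounded2 neg_le_0_iff_le)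
  have "0 < y i" if i: "i < p" for i
  proof (rule ccontr)
    assume "\<not> 0 < y i"
    then have "y i = 0" using y0[OF i] by simp
    then have "M $$ (i, k) * y k \<le> 0" if "k < p" for k
      using off[OF i that] y0[OF that] by (cases "i = k") (auto simp: mult_nonpos_nonneg)
    then have "(\<Sum>k<p. M $$ (i, k) * y k) \<le> 0" by (intro sum_nonpos) auto
    then show False using My[OF i] by simp
  qed
  then show ?thesis using My by (intro exI[of _ y]) auto
qed

text \<open>The Cauchy-Schwarz inequality for the factors \<open>sqrt \<gamma>\<^sub>i d\<^sub>i x\<^sub>i\<close> and \<open>1 / sqrt \<gamma>\<^sub>i\<close>, obtained by expanding
the nonnegative sum of \<open>\<gamma>\<^sub>i (d\<^sub>i x\<^sub>i - (a / g) / \<gamma>\<^sub>i)\<^sup>2\<close>, where \<open>a\<close> is the sum of the \<open>d\<^sub>i x\<^sub>i\<close> and \<open>g\<close> that of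
the \<open>1 / \<gamma>\<^sub>i\<close>.\<close>
lemma weighted_sum_square_bound:
  fixes \<gamma> d x :: "nat \<Rightarrow> real"
  assumes "\<And>i. i < p \<Longrightarrow> 0 < \<gamma> i"
  shows "(\<Sum>i<p. d i * x i)\<^sup>2 / (\<Sum>i<p. 1 / \<gamma> i) \<le> (\<Sum>i<p. \<gamma> i * (d i)\<^sup>2 * (x i)\<^sup>2)"
proof (cases "p = 0")
  case False
  define g where "g = (\<Sum>i<p. 1 / \<gamma> i)"
  define a where "a = (\<Sum>i<p. d i * x i)"
  have expand_square: "c * (b - e / c)\<^sup>2 = c * b\<^sup>2 - 2 * e * b + e\<^sup>2 * (1 / c)"
    if "c \<noteq> 0" for b c e :: real
    using that by (simp add: power2_eq_square field_simps)
  have g: "g > 0" unfolding g_def using False assms by (intro sum_pos) auto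
  have "0 \<le> (\<Sum>i<p. \<gamma> i * (d i * x i - (a / g) / \<gamma> i)\<^sup>2)"
    using assms by (intro sum_nonneg) (auto simp: less_imp_le)
  also have "\<dots> = (\<Sum>i<p. \<gamma> i * (d i)\<^sup>2 * (x i)\<^sup>2 - 2 * (a / g) * (d i * x i) + (a / g)\<^sup>2 * (1 / \<gamma> i))"
  proof (intro sum.cong refl)
    fix i assume "i \<in> {..<p}"
    then have "\<gamma> i \<noteq> 0" using assms[of i] by auto
    then show "\<gamma> i * (d i * x i - (a / g) / \<gamma> i)\<^sup>2
        = \<gamma> i * (d i)\<^sup>2 * (x i)\<^sup>2 - 2 * (a / g) * (d i * x i) + (a / g)\<^sup>2 * (1 / \<gamma> i)"
      using expand_square[of "\<gamma> i" "d i * x i" "a / g"] by (simp only: power_mult_distrib mult.assoc not_False_eq_True simp_thms)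
  qed
  also have "\<dots> = (\<Sum>i<p. \<gamma> i * (d i)\<^sup>2 * (x i)\<^sup>2) - 2 * (a / g) * a + (a / g)\<^sup>2 * g"
    unfolding a_def g_def by (simp add: sum.distrib sum_subtractf sum_distrib_left)
  also have "\<dots> = (\<Sum>i<p. \<gamma> i * (d i)\<^sup>2 * (x i)\<^sup>2) - a\<^sup>2 / g"
    using g by (simp add: power2_eq_square field_simps)
  finally show ?thesis unfolding a_def g_def by simp
qed simp

text \<open>The heart of the passage from diagonal scalings to entrywise multipliers. The matrix
\<open>M = T - D S D\<^sup>T\<close> is positive definite and, since \<open>D\<close> and \<open>S\<close> are nonnegative, has no positive
off-diagonal entries, so there is a positive vector \<open>y\<close> with \<open>M y > 0\<close>. With \<open>c = D\<^sup>T y\<close> the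
multipliers \<open>\<gamma>\<^sub>i\<^sub>j = s\<^sub>j c\<^sub>j / (D\<^sub>i\<^sub>j y\<^sub>i)\<close> turn the weighted row sums of \<open>D\<^sub>i\<^sub>j\<^sup>2\<close> into \<open>(D S D\<^sup>T y)\<^sub>i / y\<^sub>i < t\<^sub>i\<close> and
satisfy \<open>\<Sum>\<^sub>i 1 / \<gamma>\<^sub>i\<^sub>j = 1 / s\<^sub>j\<close>. Where \<open>D\<^sub>i\<^sub>j = 0\<close> the multiplier has to be large but finite, which
costs the \<open>\<epsilon>\<close>.\<close>
lemma exists_multipliers:
  fixes D :: "real mat" and s t :: "nat \<Rightarrow> real"
  assumes D: "D \<in> carrier_mat p n" and nonneg: "\<And>i j. i < p \<Longrightarrow> j < n \<Longrightarrow> 0 \<le> D $$ (i, j)"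
    and s: "\<And>j. j < n \<Longrightarrow> 0 < s j" and \<epsilon>: "0 < \<epsilon>"
    and less: "\<And>x. x \<in> carrier_vec p \<Longrightarrow> x \<noteq> 0\<^sub>v p \<Longrightarrow>
      (\<Sum>j<n. s j * (col D j \<bullet> x)\<^sup>2) < (\<Sum>i<p. t i * (x $ i)\<^sup>2)"
  shows "\<exists>\<gamma>. (\<forall>i<p. \<forall>j<n. 0 < \<gamma> i j) \<and> (\<forall>i<p. (\<Sum>j<n. \<gamma> i j * (D $$ (i, j))\<^sup>2) \<le> t i) \<and>
    (\<forall>j<n. (\<Sum>i<p. 1 / \<gamma> i j) \<le> 1 / s j + \<epsilon>)"
proof -
  define M where "M = mat_diag p t - D * mat_diag n s * transpose_mat D"
  have gram: "D * mat_diag n s * transpose_mat D \<in> carrier_mat p p" using D by auto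
  then have M: "M \<in> carrier_mat p p" unfolding M_def by (rule minus_carrier_mat)
  have ind: "M $$ (i, k) = (if i = k then t i else 0) - (\<Sum>j<n. D $$ (i, j) * s j * D $$ (k, j))"
    if "i < p" "k < p" for i k
    using that D unfolding M_def mat_diag_mult_right[OF D]
    by (auto simp: mat_diag_def scalar_prod_def atLeast0LessThan intro!: sum.cong)
  have "0 < x \<bullet> (M *\<^sub>v x)" if "x \<in> carrier_vec p" "x \<noteq> 0\<^sub>v p" for x
    using less[OF that] unfolding M_def quadratic_form_minus[OF mat_diag_dim gram that(1)]
      quadratic_form_gram[OF D that(1)] quadratic_form_mat_diag[OF that(1)] by simp
  moreover have "M $$ (i, k) \<le> 0" if "i < p" "k < p" "i \<noteq> k" for i k
    using that nonneg s by (auto simp: ind less_imp_le intro!: sum_nonneg)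
  ultimately obtain y where y: "\<And>i. i < p \<Longrightarrow> 0 < y i"
      "\<And>i. i < p \<Longrightarrow> 0 < (\<Sum>k<p. M $$ (i, k) * y k)"
    using pos_definite_Z_matrix_positive_vector[OF M] by blast
  define c where "c = (\<lambda>j. \<Sum>k<p. D $$ (k, j) * y k)"
  have t: "(\<Sum>j<n. D $$ (i, j) * (s j * c j)) < t i * y i" if i: "i < p" for i
  proof -
    have "(\<Sum>k<p. M $$ (i, k) * y k)
        = (\<Sum>k<p. (if k = i then t i * y i else 0) - (\<Sum>j<n. D $$ (i, j) * s j * D $$ (k, j)) * y k)"
      using i by (intro sum.cong) (auto simp: ind left_diff_distrib)
    also have "\<dots> = t i * y i - (\<Sum>k<p. \<Sum>j<n. D $$ (i, j) * s j * D $$ (k, j) * y k)"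
      using i by (simp add: sum_subtractf sum_distrib_right)
    also have "(\<Sum>k<p. \<Sum>j<n. D $$ (i, j) * s j * D $$ (k, j) * y k) = (\<Sum>j<n. D $$ (i, j) * (s j * c j))"
      unfolding c_def by (subst sum.swap) (simp add: sum_distrib_left ac_simps)
    finally show ?thesis using y(2)[OF i] by simp
  qed
  have c_ge: "D $$ (i, j) * y i \<le> c j" if "i < p" "j < n" for i j
    unfolding c_def using that nonneg y(1)
    by (intro member_le_sum[of i "{..<p}" "\<lambda>k. D $$ (k, j) * y k"]) (auto simp: less_imp_le)
  \<comment> \<open>If \<open>c j = 0\<close>, then column \<open>j\<close> of \<open>D\<close> vanishes, and division by zero gives the right value 0.\<close>
  define r where "r = (\<lambda>i j. D $$ (i, j) * y i / (s j * c j))"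
  have r0: "0 \<le> r i j" if "i < p" "j < n" for i j
  proof -
    have "0 \<le> D $$ (i, j) * y i" using that nonneg y(1) by (simp add: less_imp_le)
    moreover from this have "0 \<le> c j" using c_ge[OF that] by linarith
    ultimately show ?thesis unfolding r_def using s[OF that(2)] by simp
  qed
  define \<gamma> where "\<gamma> = (\<lambda>i j. 1 / (r i j + \<epsilon> / p))"
  have rpos: "0 < r i j + \<epsilon> / p" if "i < p" "j < n" for i j
    using r0[OF that] \<epsilon> that by (intro add_nonneg_pos) auto
  have "(\<Sum>j<n. \<gamma> i j * (D $$ (i, j))\<^sup>2) \<le> t i" if i: "i < p" for i
  proof -
    have "\<gamma> i j * (D $$ (i, j))\<^sup>2 \<le> D $$ (i, j) * (s j * c j) / y i" if j: "j < n" for j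
    proof (cases "D $$ (i, j) = 0")
      case False
      then have d: "0 < D $$ (i, j)" using nonneg[OF i j] by simp
      then have "0 < D $$ (i, j) * y i" using y(1)[OF i] by simp
      then have cj: "0 < c j" using c_ge[OF i j] by linarith
      have r: "0 < r i j" unfolding r_def using d y(1)[OF i] s[OF j] cj by simp
      have "\<gamma> i j \<le> 1 / r i j"
        unfolding \<gamma>_def using r \<epsilon> by (intro divide_left_mono) (auto intro!: mult_pos_pos add_pos_nonneg)
      then have "\<gamma> i j * (D $$ (i, j))\<^sup>2 \<le> 1 / r i j * (D $$ (i, j))\<^sup>2"
        by (intro mult_right_mono) auto
      also have "\<dots> = D $$ (i, j) * (s j * c j) / y i"
        unfolding r_def using d y(1)[OF i] s[OF j] cj by (simp add: power2_eq_square field_simps)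
      finally show ?thesis .
    qed simp
    then have "(\<Sum>j<n. \<gamma> i j * (D $$ (i, j))\<^sup>2) \<le> (\<Sum>j<n. D $$ (i, j) * (s j * c j) / y i)"
      by (intro sum_mono) auto
    also have "\<dots> = (\<Sum>j<n. D $$ (i, j) * (s j * c j)) / y i" by (simp add: sum_divide_distrib)
    also have "\<dots> \<le> t i" using t[OF i] y(1)[OF i] by (simp add: divide_le_eq)
    finally show ?thesis .
  qed
  moreover have "(\<Sum>i<p. 1 / \<gamma> i j) \<le> 1 / s j + \<epsilon>" if j: "j < n" for j
  proof -
    have "(\<Sum>i<p. 1 / \<gamma> i j) = c j / (s j * c j) + (\<Sum>i<p. \<epsilon> / p)"
      unfolding \<gamma>_def r_def c_def by (simp add: sum.distrib sum_divide_distrib)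
    moreover have "(\<Sum>i<p. \<epsilon> / p) \<le> \<epsilon>" using \<epsilon> by simp
    moreover have "c j / (s j * c j) \<le> 1 / s j" using s[OF j] by (cases "c j = 0") auto
    ultimately show ?thesis by linarith
  qed
  moreover have "0 < \<gamma> i j" if "i < p" "j < n" for i j
    unfolding \<gamma>_def using rpos[OF that] by simp
  ultimately show ?thesis by blast
qed

section \<open>Reduction of the block inequalities\<close>

text \<open>The common form of the three matrix inequalities after elimination of the second block: the matrix
\<open>Z + diag t + E\<^sup>T diag g E\<close> is negative definite.\<close>
definition reduced_lmi :: "real mat \<Rightarrow> real mat \<Rightarrow> (nat \<Rightarrow> real) \<Rightarrow> (nat \<Rightarrow> real) \<Rightarrow> bool" where
  "reduced_lmi Z E t g \<longleftrightarrow> symmetric_mat Z \<and>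
     (\<forall>x \<in> carrier_vec (dim_row Z). x \<noteq> 0\<^sub>v (dim_row Z) \<longrightarrow>
        x \<bullet> (Z *\<^sub>v x) + (\<Sum>i<dim_row Z. t i * (x $ i)\<^sup>2) + (\<Sum>j<dim_row E. g j * (row E j \<bullet> x)\<^sup>2) < 0)"

lemma symmetric_mat_uminus: "symmetric_mat (- A) \<longleftrightarrow> symmetric_mat A"
  unfolding symmetric_mat_def by (auto simp: transpose_uminus)

lemma symmetric_mat_add_diag:
  assumes "Z \<in> carrier_mat p p"
  shows "symmetric_mat (Z + mat_diag p t) \<longleftrightarrow> symmetric_mat Z"
proof -
  have sum: "Z + mat_diag p t \<in> carrier_mat p p" by simp
  show ?thesis
    unfolding symmetric_mat_iff[OF sum] symmetric_mat_iff[OF assms]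
    using assms by (auto simp: mat_diag_def) metis
qed

lemma def_less_zero_iff:
  assumes "M \<in> carrier_mat p p"
  shows "M \<prec>\<^sub>d 0\<^sub>m p p \<longleftrightarrow> pos_def (- M)"
proof -
  have "0\<^sub>m p p - M = - M" using assms by (intro eq_matI) auto
  moreover have "symmetric_mat (0\<^sub>m p p)" by (simp add: symmetric_mat_def)
  ultimately show ?thesis using assms
    unfolding def_less_def pos_def_def by (auto simp: symmetric_mat_uminus)
qed

lemma zero_def_less_iff:
  assumes "M \<in> carrier_mat p p"
  shows "0\<^sub>m p p \<prec>\<^sub>d M \<longleftrightarrow> pos_def M"
proof -
  have "M - 0\<^sub>m p p = M" using assms by (intro eq_matI) auto
  moreover have "symmetric_mat (0\<^sub>m p p)" by (simp add: symmetric_mat_def)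
  ultimately show ?thesis using assms
    unfolding def_less_def pos_def_def by auto
qed

lemma uminus_four_block_mat:
  fixes A B C D :: "real mat"
  assumes "A \<in> carrier_mat p p" "B \<in> carrier_mat p q" "C \<in> carrier_mat q p" "D \<in> carrier_mat q q"
  shows "- four_block_mat A B C D = four_block_mat (- A) (- B) (- C) (- D)"
  using assms by (intro eq_matI) auto

text \<open>The hypothesis \<open>sums\<close> says that \<open>B diag (1/c) B\<^sup>T = E\<^sup>T diag g E\<close> as quadratic forms, so that the
Schur complement depends on the block \<open>B\<close> only through \<open>g\<close>.\<close>
lemma pos_def_block_iff_reduced_lmi:
  assumes Z: "Z \<in> carrier_mat p p" and E: "E \<in> carrier_mat n p" and B: "B \<in> carrier_mat p q"
    and sums: "\<And>x. x \<in> carrier_vec p \<Longrightarrow>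
      (\<Sum>k<q. (col B k \<bullet> x)\<^sup>2 / c k) = (\<Sum>j<n. g j * (row E j \<bullet> x)\<^sup>2)"
  shows "pos_def (four_block_mat (- (Z + mat_diag p t)) B (transpose_mat B) (mat_diag q c)) \<longleftrightarrow>
    (\<forall>k<q. 0 < c k) \<and> reduced_lmi Z E t g"
proof -
  have T: "Z + mat_diag p t \<in> carrier_mat p p" by simp
  then have nT: "- (Z + mat_diag p t) \<in> carrier_mat p p" by simp
  have dims: "dim_row Z = p" "dim_row E = n" using Z E by auto
  have form: "x \<bullet> (- (Z + mat_diag p t) *\<^sub>v x) = - (x \<bullet> (Z *\<^sub>v x)) - (\<Sum>i<p. t i * (x $ i)\<^sup>2)"
    if x: "x \<in> carrier_vec p" for x
    unfolding quadratic_form_uminus[OF T x] quadratic_form_add[OF Z mat_diag_dim x]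
      quadratic_form_mat_diag[OF x] by simp
  have "(\<forall>x\<in>carrier_vec p. x \<noteq> 0\<^sub>v p \<longrightarrow>
        (\<Sum>k<q. (col B k \<bullet> x)\<^sup>2 / c k) < x \<bullet> (- (Z + mat_diag p t) *\<^sub>v x)) \<longleftrightarrow>
      (\<forall>x\<in>carrier_vec p. x \<noteq> 0\<^sub>v p \<longrightarrow>
        x \<bullet> (Z *\<^sub>v x) + (\<Sum>i<p. t i * (x $ i)\<^sup>2) + (\<Sum>j<n. g j * (row E j \<bullet> x)\<^sup>2) < 0)"
    by (intro ball_cong refl) (auto simp: form sums simp del: uminus_mult_mat_vec)
  then show ?thesis
    unfolding schur_complement_diag[OF nT B] reduced_lmi_def dims symmetric_mat_uminus
      symmetric_mat_add_diag[OF Z] by blast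
qed

lemma sum_div_mod:
  fixes f :: "nat \<Rightarrow> nat \<Rightarrow> real"
  shows "(\<Sum>k<p * n. f (k div n) (k mod n)) = (\<Sum>i<p. \<Sum>j<n. f i j)"
proof -
  have "(\<Sum>k<p * n. f (k div n) (k mod n)) = (\<Sum>i<p. \<Sum>k\<in>{i * n..<i * n + n}. f (k div n) (k mod n))"
    by (rule sum.nat_group[symmetric])
  also have "\<dots> = (\<Sum>i<p. \<Sum>j<n. f i j)"
  proof (rule sum.cong[OF refl])
    fix i
    have "(\<Sum>k\<in>{i * n..<i * n + n}. f (k div n) (k mod n))
        = (\<Sum>j\<in>{0..<n}. f ((j + i * n) div n) ((j + i * n) mod n))"
      using sum.shift_bounds_nat_ivl[of "\<lambda>k. f (k div n) (k mod n)" 0 "i * n" n] by (simp add: add.commute)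
    also have "\<dots> = (\<Sum>j<n. f i j)"
      unfolding atLeast0LessThan by (intro sum.cong) auto
    finally show "(\<Sum>k\<in>{i * n..<i * n + n}. f (k div n) (k mod n)) = (\<Sum>j<n. f i j)" .
  qed
  finally show ?thesis .
qed

lemma all_div_mod:
  fixes p n :: nat
  shows "(\<forall>k<p * n. Q (k div n) (k mod n)) \<longleftrightarrow> (\<forall>i<p. \<forall>j<n. Q i j)"
proof (intro iffI allI impI)
  fix i j assume Q: "\<forall>k<p * n. Q (k div n) (k mod n)" and ij: "i < p" "j < n"
  have "i * n + j < (i + 1) * n" using ij by simp
  also have "\<dots> \<le> p * n" using ij by (intro mult_right_mono) auto
  finally have "Q ((i * n + j) div n) ((i * n + j) mod n)" using Q by blast
  then show "Q i j" using ij by simp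
next
  fix k assume Q: "\<forall>i<p. \<forall>j<n. Q i j" and k: "k < p * n"
  then have "0 < n" by (cases n) auto
  then show "Q (k div n) (k mod n)" using Q k by (simp add: less_mult_imp_div_less)
qed

text \<open>The transpose of \<open>E\<close>, repeated \<open>p\<close> times side by side.\<close>
definition replicate_block :: "nat \<Rightarrow> real mat \<Rightarrow> real mat" where
  "replicate_block p E = mat (dim_col E) (p * dim_row E) (\<lambda>(r, k). E $$ (k mod dim_row E, r))"

text \<open>The \<open>p\<close> copies of row \<open>j\<close> of \<open>E\<close> contribute the same square with weights \<open>1 / \<gamma> i j\<close>; this is how a
whole column of multipliers acts only through the sum of its reciprocals.\<close>
lemma replicate_block_sum:
  assumes E: "E \<in> carrier_mat n p" and x: "x \<in> carrier_vec p"
  shows "(\<Sum>k<p * n. (col (replicate_block p E) k \<bullet> x)\<^sup>2 / \<gamma> (k div n) (k mod n))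
    = (\<Sum>j<n. (\<Sum>i<p. 1 / \<gamma> i j) * (row E j \<bullet> x)\<^sup>2)"
proof -
  have "(\<Sum>k<p * n. (col (replicate_block p E) k \<bullet> x)\<^sup>2 / \<gamma> (k div n) (k mod n))
      = (\<Sum>k<p * n. (row E (k mod n) \<bullet> x)\<^sup>2 / \<gamma> (k div n) (k mod n))"
  proof (intro sum.cong refl)
    fix k assume "k \<in> {..<p * n}"
    then have k: "k < p * n" by simp
    then have "0 < n" by (cases n) auto
    then have "col (replicate_block p E) k = row E (k mod n)"
      using k E by (intro eq_vecI) (auto simp: replicate_block_def)
    then show "(col (replicate_block p E) k \<bullet> x)\<^sup>2 / \<gamma> (k div n) (k mod n)
        = (row E (k mod n) \<bullet> x)\<^sup>2 / \<gamma> (k div n) (k mod n)" by simp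
  qed
  also have "\<dots> = (\<Sum>i<p. \<Sum>j<n. (row E j \<bullet> x)\<^sup>2 / \<gamma> i j)"
    by (rule sum_div_mod[of "\<lambda>i j. (row E j \<bullet> x)\<^sup>2 / \<gamma> i j"])
  also have "\<dots> = (\<Sum>j<n. (\<Sum>i<p. 1 / \<gamma> i j) * (row E j \<bullet> x)\<^sup>2)"
    by (subst sum.swap) (simp add: sum_distrib_right)
  finally show ?thesis .
qed

lemma col_uminus_square_sum:
  assumes B: "B \<in> carrier_mat p q" and x: "(x :: real vec) \<in> carrier_vec p"
  shows "(\<Sum>k<q. (col (- B) k \<bullet> x)\<^sup>2 / c k) = (\<Sum>k<q. (col B k \<bullet> x)\<^sup>2 / c k)"
  using assms by (intro sum.cong refl) auto

lemma replicated_block_neg_def_iff: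
  assumes Z: "Z \<in> carrier_mat p p" and E: "E \<in> carrier_mat n p"
  shows "four_block_mat (Z + mat_diag p t) (replicate_block p E) (transpose_mat (replicate_block p E))
      (- mat_diag (p * n) (\<lambda>k. \<gamma> (k div n) (k mod n))) \<prec>\<^sub>d 0\<^sub>m (p + p * n) (p + p * n) \<longleftrightarrow>
    (\<forall>i<p. \<forall>j<n. 0 < \<gamma> i j) \<and> reduced_lmi Z E t (\<lambda>j. \<Sum>i<p. 1 / \<gamma> i j)"
proof -
  let ?U = "replicate_block p E" and ?V = "mat_diag (p * n) (\<lambda>k. \<gamma> (k div n) (k mod n))"
  have T: "Z + mat_diag p t \<in> carrier_mat p p" by simp
  have U: "?U \<in> carrier_mat p (p * n)" using E by (auto simp: replicate_block_def)
  have V: "- ?V \<in> carrier_mat (p * n) (p * n)" by simp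
  have M: "four_block_mat (Z + mat_diag p t) ?U (transpose_mat ?U) (- ?V)
      \<in> carrier_mat (p + p * n) (p + p * n)" using T V by auto
  have "- four_block_mat (Z + mat_diag p t) ?U (transpose_mat ?U) (- ?V)
      = four_block_mat (- (Z + mat_diag p t)) (- ?U) (transpose_mat (- ?U)) ?V"
    using U by (subst uminus_four_block_mat[OF T U _ V]) (auto simp: transpose_uminus)
  moreover have "pos_def \<dots> \<longleftrightarrow> (\<forall>k<p * n. 0 < \<gamma> (k div n) (k mod n)) \<and>
      reduced_lmi Z E t (\<lambda>j. \<Sum>i<p. 1 / \<gamma> i j)"
    using U by (intro pos_def_block_iff_reduced_lmi[OF Z E])
      (auto simp: col_uminus_square_sum[OF U] replicate_block_sum[OF E])
  ultimately show ?thesis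
    unfolding def_less_zero_iff[OF M] all_div_mod[of p n "\<lambda>i j. 0 < \<gamma> i j"] by simp
qed

lemma replicated_block_pos_def_iff:
  assumes Y: "Y \<in> carrier_mat p p" and E: "E \<in> carrier_mat n p"
  shows "0\<^sub>m (p + p * n) (p + p * n) \<prec>\<^sub>d four_block_mat (Y - mat_diag p t) (replicate_block p E)
      (transpose_mat (replicate_block p E)) (mat_diag (p * n) (\<lambda>k. \<gamma> (k div n) (k mod n))) \<longleftrightarrow>
    (\<forall>i<p. \<forall>j<n. 0 < \<gamma> i j) \<and> reduced_lmi (- Y) E t (\<lambda>j. \<Sum>i<p. 1 / \<gamma> i j)"
proof -
  let ?U = "replicate_block p E" and ?V = "mat_diag (p * n) (\<lambda>k. \<gamma> (k div n) (k mod n))"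
  have eq: "Y - mat_diag p t = - (- Y + mat_diag p t)"
    using Y by (intro eq_matI) (auto simp: mat_diag_def)
  have nY: "- Y \<in> carrier_mat p p" using Y by simp
  have U: "?U \<in> carrier_mat p (p * n)" using E by (auto simp: replicate_block_def)
  have M: "four_block_mat (Y - mat_diag p t) ?U (transpose_mat ?U) ?V
      \<in> carrier_mat (p + p * n) (p + p * n)" by (intro four_block_carrier_mat minus_carrier_mat) auto
  have "pos_def (four_block_mat (Y - mat_diag p t) ?U (transpose_mat ?U) ?V) \<longleftrightarrow>
      (\<forall>k<p * n. 0 < \<gamma> (k div n) (k mod n)) \<and> reduced_lmi (- Y) E t (\<lambda>j. \<Sum>i<p. 1 / \<gamma> i j)"
    unfolding eq by (intro pos_def_block_iff_reduced_lmi[OF nY E U] replicate_block_sum[OF E])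
  then show ?thesis
    unfolding zero_def_less_iff[OF M] all_div_mod[of p n "\<lambda>i j. 0 < \<gamma> i j"] .
qed

lemma diagonal_block_neg_def_iff:
  assumes Z: "Z \<in> carrier_mat p p" and E: "E \<in> carrier_mat n p"
  shows "four_block_mat (Z + mat_diag p t) (transpose_mat E) E (- mat_diag n s) \<prec>\<^sub>d 0\<^sub>m (p + n) (p + n)
    \<longleftrightarrow> (\<forall>j<n. 0 < s j) \<and> reduced_lmi Z E t (\<lambda>j. 1 / s j)"
proof -
  have T: "Z + mat_diag p t \<in> carrier_mat p p" by simp
  have Et: "transpose_mat E \<in> carrier_mat p n" using E by simp
  have S: "- mat_diag n s \<in> carrier_mat n n" by simp
  have M: "four_block_mat (Z + mat_diag p t) (transpose_mat E) E (- mat_diag n s)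
      \<in> carrier_mat (p + n) (p + n)" using T S by auto
  have "- four_block_mat (Z + mat_diag p t) (transpose_mat E) E (- mat_diag n s)
      = four_block_mat (- (Z + mat_diag p t)) (- transpose_mat E) (transpose_mat (- transpose_mat E)) (mat_diag n s)"
    by (subst uminus_four_block_mat[OF T Et E S]) (simp add: transpose_uminus)
  moreover have "pos_def \<dots> \<longleftrightarrow> (\<forall>j<n. 0 < s j) \<and> reduced_lmi Z E t (\<lambda>j. 1 / s j)"
    using E by (intro pos_def_block_iff_reduced_lmi[OF Z E])
      (auto simp: col_uminus_square_sum[OF Et] intro!: sum.cong)
  ultimately show ?thesis unfolding def_less_zero_iff[OF M] by simp
qed

lemma gram_less_diag_iff:
  fixes D :: "real mat"
  assumes D: "D \<in> carrier_mat p n"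
  shows "D * mat_diag n s * transpose_mat D \<prec>\<^sub>d mat_diag p t \<longleftrightarrow>
    (\<forall>x \<in> carrier_vec p. x \<noteq> 0\<^sub>v p \<longrightarrow> (\<Sum>j<n. s j * (col D j \<bullet> x)\<^sup>2) < (\<Sum>i<p. t i * (x $ i)\<^sup>2))"
proof -
  let ?G = "D * mat_diag n s * transpose_mat D"
  have G: "?G \<in> carrier_mat p p" using D by auto
  have M: "mat_diag p t - ?G \<in> carrier_mat p p" using G by (rule minus_carrier_mat)
  have "symmetric_mat (mat_diag p t - ?G)"
    using symmetric_gram[OF D, of s] symmetric_mat_diag[of p t] G
    unfolding symmetric_mat_iff[OF M] symmetric_mat_iff[OF G] symmetric_mat_iff[OF mat_diag_dim]
    by auto
  moreover have "0 < x \<bullet> ((mat_diag p t - ?G) *\<^sub>v x) \<longleftrightarrow>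
      (\<Sum>j<n. s j * (col D j \<bullet> x)\<^sup>2) < (\<Sum>i<p. t i * (x $ i)\<^sup>2)" if "x \<in> carrier_vec p" for x
    unfolding quadratic_form_minus[OF mat_diag_dim G that] quadratic_form_gram[OF D that]
      quadratic_form_mat_diag[OF that] by simp
  moreover have "dim_row (mat_diag p t - ?G) = p" "dim_row ?G = p" using G by auto
  moreover have "dim_row (mat_diag p t) = p" by (simp add: mat_diag_def)
  ultimately show ?thesis
    unfolding def_less_def pos_def_def using symmetric_gram[OF D, of s] symmetric_mat_diag[of p t] by simp
qed

lemma reduced_lmi_mono:
  assumes red: "reduced_lmi Z E t g" and Z: "Z \<in> carrier_mat p p" and E: "E \<in> carrier_mat n p"
    and t: "\<And>i. i < p \<Longrightarrow> t' i \<le> t i" and g: "\<And>j. j < n \<Longrightarrow> g' j \<le> g j"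
  shows "reduced_lmi Z E t' g'"
  unfolding reduced_lmi_def
proof (intro conjI ballI impI)
  show "symmetric_mat Z" using red unfolding reduced_lmi_def by simp
  fix x :: "real vec" assume x: "x \<in> carrier_vec (dim_row Z)" "x \<noteq> 0\<^sub>v (dim_row Z)"
  have "(\<Sum>i<dim_row Z. t' i * (x $ i)\<^sup>2) \<le> (\<Sum>i<dim_row Z. t i * (x $ i)\<^sup>2)"
    using Z t by (intro sum_mono mult_right_mono) auto
  moreover have "(\<Sum>j<dim_row E. g' j * (row E j \<bullet> x)\<^sup>2) \<le> (\<Sum>j<dim_row E. g j * (row E j \<bullet> x)\<^sup>2)"
    using E g by (intro sum_mono mult_right_mono) auto
  moreover have "x \<bullet> (Z *\<^sub>v x) + (\<Sum>i<dim_row Z. t i * (x $ i)\<^sup>2)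
      + (\<Sum>j<dim_row E. g j * (row E j \<bullet> x)\<^sup>2) < 0"
    using red x unfolding reduced_lmi_def by blast
  ultimately show "x \<bullet> (Z *\<^sub>v x) + (\<Sum>i<dim_row Z. t' i * (x $ i)\<^sup>2)
      + (\<Sum>j<dim_row E. g' j * (row E j \<bullet> x)\<^sup>2) < 0" by linarith
qed

text \<open>Both kinds of weights can be enlarged at once, because the form with all weights equal to one is a
quadratic form too.\<close>
lemma reduced_lmi_slack:
  assumes red: "reduced_lmi Z E t g" and Z: "Z \<in> carrier_mat p p" and E: "E \<in> carrier_mat n p"
  shows "\<exists>\<epsilon>>0. reduced_lmi Z E (\<lambda>i. t i + \<epsilon>) (\<lambda>j. g j + \<epsilon>)"
proof -
  have dims: "dim_row Z = p" "dim_row E = n" using Z E by auto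
  let ?gram = "\<lambda>h. transpose_mat E * mat_diag n h * transpose_mat (transpose_mat E)"
  define A where "A = - (Z + (mat_diag p t + ?gram g))"
  define H where "H = mat_diag p (\<lambda>_. 1) + ?gram (\<lambda>_. 1)"
  have Et: "transpose_mat E \<in> carrier_mat p n" using E by simp
  have gram: "?gram h \<in> carrier_mat p p" for h using E by auto
  have tg: "mat_diag p t' + ?gram h \<in> carrier_mat p p" for t' h using gram by (rule add_carrier_mat)
  have Ztg: "Z + (mat_diag p t + ?gram g) \<in> carrier_mat p p" using tg by (rule add_carrier_mat)
  then have A: "A \<in> carrier_mat p p" and H: "H \<in> carrier_mat p p"
    unfolding A_def H_def using tg by (auto simp del: mat_diag_one)
  have form_tg: "x \<bullet> ((mat_diag p t' + ?gram h) *\<^sub>v x)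
      = (\<Sum>i<p. t' i * (x $ i)\<^sup>2) + (\<Sum>j<n. h j * (row E j \<bullet> x)\<^sup>2)"
    if x: "x \<in> carrier_vec p" for x t' h
    unfolding quadratic_form_add[OF mat_diag_dim gram x] quadratic_form_mat_diag[OF x]
      quadratic_form_gram[OF Et x] using E by simp
  have form_A: "x \<bullet> (A *\<^sub>v x) = - (x \<bullet> (Z *\<^sub>v x) + (\<Sum>i<p. t i * (x $ i)\<^sup>2)
      + (\<Sum>j<n. g j * (row E j \<bullet> x)\<^sup>2))" if x: "x \<in> carrier_vec p" for x
    unfolding A_def quadratic_form_uminus[OF Ztg x] quadratic_form_add[OF Z tg x] form_tg[OF x] by simp
  have form_H: "x \<bullet> (H *\<^sub>v x) = (\<Sum>i<p. (x $ i)\<^sup>2) + (\<Sum>j<n. (row E j \<bullet> x)\<^sup>2)"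
    if x: "x \<in> carrier_vec p" for x
    unfolding H_def form_tg[OF x] by simp
  have "0 < x \<bullet> (A *\<^sub>v x)" if "x \<in> carrier_vec p" "x \<noteq> 0\<^sub>v p" for x
    using red that unfolding form_A[OF that(1)] reduced_lmi_def dims by auto
  then obtain \<epsilon> where \<epsilon>: "0 < \<epsilon>" "\<And>x. x \<in> carrier_vec p \<Longrightarrow> x \<noteq> 0\<^sub>v p \<Longrightarrow>
      \<epsilon> * (x \<bullet> (H *\<^sub>v x)) < x \<bullet> (A *\<^sub>v x)"
    using quadratic_form_slack[OF A H] by blast
  have "reduced_lmi Z E (\<lambda>i. t i + \<epsilon>) (\<lambda>j. g j + \<epsilon>)"
    unfolding reduced_lmi_def dims
  proof (intro conjI ballI impI)
    show "symmetric_mat Z" using red unfolding reduced_lmi_def by simp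
    fix x :: "real vec" assume x: "x \<in> carrier_vec p" "x \<noteq> 0\<^sub>v p"
    show "x \<bullet> (Z *\<^sub>v x) + (\<Sum>i<p. (t i + \<epsilon>) * (x $ i)\<^sup>2) + (\<Sum>j<n. (g j + \<epsilon>) * (row E j \<bullet> x)\<^sup>2) < 0"
      using \<epsilon>(2)[OF x] unfolding form_A[OF x(1)] form_H[OF x(1)]
      by (simp add: distrib_right distrib_left sum.distrib sum_distrib_left)
  qed
  then show ?thesis using \<epsilon>(1) by blast
qed

section \<open>Equivalence of the reduced conditions\<close>

lemma diagonal_mat_eq_mat_diag:
  assumes "A \<in> carrier_mat p p" "diagonal_mat A"
  shows "A = mat_diag p (\<lambda>i. A $$ (i, i))"
  using assms by (intro eq_matI) (auto simp: diagonal_mat_def mat_diag_def)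

text \<open>From multipliers to diagonal matrices, \<open>s\<^sub>j\<close> is the reciprocal of \<open>\<Sum>\<^sub>i 1 / \<gamma>\<^sub>i\<^sub>j\<close> and \<open>t\<^sub>i\<close> is
\<open>\<Sum>\<^sub>j \<gamma>\<^sub>i\<^sub>j D\<^sub>i\<^sub>j\<^sup>2\<close>; the Cauchy-Schwarz inequality gives only \<open>D S D\<^sup>T \<preceq> diag t\<close>, and the slack in the
reduced inequality makes it strict. Conversely the slack absorbs the \<open>\<epsilon>\<close> that the construction of
the multipliers costs. The bound \<open>n \<le> p\<close> excludes empty sums, whose reciprocal is not positive.\<close>
lemma multipliers_iff_diagonal:
  assumes Z: "Z \<in> carrier_mat p p" and E: "E \<in> carrier_mat n p" and np: "n \<le> p"
    and D: "D \<in> carrier_mat p n" and nonneg: "\<And>i j. i < p \<Longrightarrow> j < n \<Longrightarrow> 0 \<le> D $$ (i, j)"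
  shows "(\<exists>\<gamma>. (\<forall>i<p. \<forall>j<n. 0 < \<gamma> i j) \<and>
      reduced_lmi Z E (\<lambda>i. \<Sum>j<n. \<gamma> i j * (D $$ (i, j))\<^sup>2) (\<lambda>j. \<Sum>i<p. 1 / \<gamma> i j)) \<longleftrightarrow>
    (\<exists>t s. (\<forall>j<n. 0 < s j) \<and> D * mat_diag n s * transpose_mat D \<prec>\<^sub>d mat_diag p t \<and>
      reduced_lmi Z E t (\<lambda>j. 1 / s j))"
proof (intro iffI; elim exE conjE)
  fix \<gamma> :: "nat \<Rightarrow> nat \<Rightarrow> real"
  let ?t = "\<lambda>i. \<Sum>j<n. \<gamma> i j * (D $$ (i, j))\<^sup>2" and ?g = "\<lambda>j. \<Sum>i<p. 1 / \<gamma> i j"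
  assume \<gamma>: "\<forall>i<p. \<forall>j<n. 0 < \<gamma> i j" and red: "reduced_lmi Z E ?t ?g"
  obtain \<epsilon> where \<epsilon>: "0 < \<epsilon>" "reduced_lmi Z E (\<lambda>i. ?t i + \<epsilon>) (\<lambda>j. ?g j + \<epsilon>)"
    using reduced_lmi_slack[OF red Z E] by blast
  define s where "s = (\<lambda>j. 1 / ?g j)"
  have g: "0 < ?g j" if "j < n" for j
    using \<gamma> np that by (intro sum_pos) (auto simp: lessThan_empty_iff)
  have "reduced_lmi Z E (\<lambda>i. ?t i + \<epsilon>) (\<lambda>j. 1 / s j)"
    by (rule reduced_lmi_mono[OF \<epsilon>(2) Z E]) (use \<epsilon>(1) in \<open>auto simp: s_def\<close>)
  moreover have "D * mat_diag n s * transpose_mat D \<prec>\<^sub>d mat_diag p (\<lambda>i. ?t i + \<epsilon>)"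
    unfolding gram_less_diag_iff[OF D]
  proof (intro ballI impI)
    fix x :: "real vec" assume x: "x \<in> carrier_vec p" "x \<noteq> 0\<^sub>v p"
    have "(\<Sum>j<n. s j * (col D j \<bullet> x)\<^sup>2) \<le> (\<Sum>j<n. \<Sum>i<p. \<gamma> i j * (D $$ (i, j))\<^sup>2 * (x $ i)\<^sup>2)"
    proof (intro sum_mono)
      fix j assume j: "j \<in> {..<n}"
      have "col D j \<bullet> x = (\<Sum>i<p. D $$ (i, j) * x $ i)"
        using D x j by (auto simp: scalar_prod_def atLeast0LessThan intro!: sum.cong)
      then show "s j * (col D j \<bullet> x)\<^sup>2 \<le> (\<Sum>i<p. \<gamma> i j * (D $$ (i, j))\<^sup>2 * (x $ i)\<^sup>2)"
        unfolding s_def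
        using weighted_sum_square_bound[of p "\<lambda>i. \<gamma> i j" "\<lambda>i. D $$ (i, j)" "\<lambda>i. x $ i"] \<gamma> j by simp
    qed
    also have "\<dots> = (\<Sum>i<p. ?t i * (x $ i)\<^sup>2)"
      by (subst sum.swap) (simp add: sum_distrib_right)
    also have "\<dots> < (\<Sum>i<p. (?t i + \<epsilon>) * (x $ i)\<^sup>2)"
    proof -
      obtain i where "i < p" "x $ i \<noteq> 0"
        using x by (metis eq_vecI index_zero_vec carrier_vecD)
      then have "0 < (\<Sum>i<p. (x $ i)\<^sup>2)" by (intro sum_pos2[of _ i]) auto
      then show ?thesis using \<epsilon>(1) by (simp add: distrib_right sum.distrib sum_distrib_left[symmetric])
    qed
    finally show "(\<Sum>j<n. s j * (col D j \<bullet> x)\<^sup>2) < (\<Sum>i<p. (?t i + \<epsilon>) * (x $ i)\<^sup>2)" .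
  qed
  moreover have "\<forall>j<n. 0 < s j" using g by (simp add: s_def)
  ultimately show "\<exists>t s. (\<forall>j<n. 0 < s j) \<and> D * mat_diag n s * transpose_mat D \<prec>\<^sub>d mat_diag p t \<and>
      reduced_lmi Z E t (\<lambda>j. 1 / s j)" by blast
next
  fix t s :: "nat \<Rightarrow> real"
  assume s: "\<forall>j<n. 0 < s j" and less: "D * mat_diag n s * transpose_mat D \<prec>\<^sub>d mat_diag p t"
    and red: "reduced_lmi Z E t (\<lambda>j. 1 / s j)"
  obtain \<epsilon> where \<epsilon>: "0 < \<epsilon>" "reduced_lmi Z E (\<lambda>i. t i + \<epsilon>) (\<lambda>j. 1 / s j + \<epsilon>)"
    using reduced_lmi_slack[OF red Z E] by blast
  have "\<exists>\<gamma>. (\<forall>i<p. \<forall>j<n. 0 < \<gamma> i j) \<and> (\<forall>i<p. (\<Sum>j<n. \<gamma> i j * (D $$ (i, j))\<^sup>2) \<le> t i) \<and>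
      (\<forall>j<n. (\<Sum>i<p. 1 / \<gamma> i j) \<le> 1 / s j + \<epsilon>)"
    using s less \<epsilon>(1) unfolding gram_less_diag_iff[OF D]
    by (intro exists_multipliers[OF D nonneg]) auto
  then obtain \<gamma> where \<gamma>: "\<forall>i<p. \<forall>j<n. 0 < \<gamma> i j"
      "\<And>i. i < p \<Longrightarrow> (\<Sum>j<n. \<gamma> i j * (D $$ (i, j))\<^sup>2) \<le> t i"
      "\<And>j. j < n \<Longrightarrow> (\<Sum>i<p. 1 / \<gamma> i j) \<le> 1 / s j + \<epsilon>" by blast
  have "reduced_lmi Z E (\<lambda>i. \<Sum>j<n. \<gamma> i j * (D $$ (i, j))\<^sup>2) (\<lambda>j. \<Sum>i<p. 1 / \<gamma> i j)"
    by (rule reduced_lmi_mono[OF \<epsilon>(2) Z E]) (use \<gamma>(2,3) \<epsilon>(1) in \<open>fastforce+\<close>)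
  then show "\<exists>\<gamma>. (\<forall>i<p. \<forall>j<n. 0 < \<gamma> i j) \<and>
      reduced_lmi Z E (\<lambda>i. \<Sum>j<n. \<gamma> i j * (D $$ (i, j))\<^sup>2) (\<lambda>j. \<Sum>i<p. 1 / \<gamma> i j)"
    using \<gamma>(1) by blast
qed

text \<open>The slack leaves room for \<open>Y = - (Z + \<epsilon> I)\<close>; conversely the reduced inequality is monotone in \<open>Z\<close>.\<close>
lemma reduced_lmi_iff_majorant:
  assumes Z: "Z \<in> carrier_mat p p" and E: "E \<in> carrier_mat n p"
  shows "reduced_lmi Z E t g \<longleftrightarrow>
    (\<exists>Y \<in> carrier_mat p p. symmetric_mat Y \<and> Y \<prec>\<^sub>d - Z \<and> reduced_lmi (- Y) E t g)"
proof
  assume red: "reduced_lmi Z E t g"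
  then have sym: "symmetric_mat Z" unfolding reduced_lmi_def by simp
  obtain \<epsilon> where \<epsilon>: "0 < \<epsilon>" "reduced_lmi Z E (\<lambda>i. t i + \<epsilon>) (\<lambda>j. g j + \<epsilon>)"
    using reduced_lmi_slack[OF red Z E] by blast
  define I where "I = mat_diag p (\<lambda>_. \<epsilon>)"
  have I: "I \<in> carrier_mat p p" by (simp add: I_def)
  have form: "x \<bullet> (I *\<^sub>v x) = (\<Sum>i<p. \<epsilon> * (x $ i)\<^sup>2)" if "x \<in> carrier_vec p" for x
    unfolding I_def by (rule quadratic_form_mat_diag[OF that])
  have ZI: "Z + I \<in> carrier_mat p p" using I by simp
  have sum: "symmetric_mat (Z + I)" unfolding I_def symmetric_mat_add_diag[OF Z] by (rule sym)
  have dims: "dim_row Z = p" "dim_row E = n" "dim_row (Z + I) = p" "dim_row I = p" using Z E I by auto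
  have "reduced_lmi (Z + I) E t g" unfolding reduced_lmi_def dims
  proof (intro conjI ballI impI sum)
    fix x :: "real vec" assume x: "x \<in> carrier_vec p" "x \<noteq> 0\<^sub>v p"
    have "reduced_lmi Z E (\<lambda>i. t i + \<epsilon>) g"
      by (rule reduced_lmi_mono[OF \<epsilon>(2) Z E]) (use \<epsilon>(1) in auto)
    then have "x \<bullet> (Z *\<^sub>v x) + (\<Sum>i<p. (t i + \<epsilon>) * (x $ i)\<^sup>2) + (\<Sum>j<n. g j * (row E j \<bullet> x)\<^sup>2) < 0"
      using x unfolding reduced_lmi_def dims by blast
    then show "x \<bullet> ((Z + I) *\<^sub>v x) + (\<Sum>i<p. t i * (x $ i)\<^sup>2) + (\<Sum>j<n. g j * (row E j \<bullet> x)\<^sup>2) < 0"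
      unfolding quadratic_form_add[OF Z I x(1)] form[OF x(1)]
      by (simp add: distrib_right sum.distrib)
  qed
  moreover have "- (Z + I) \<prec>\<^sub>d - Z"
  proof -
    have "- Z - - (Z + I) = I" using Z I by (intro eq_matI) auto
    moreover have "pos_def I" unfolding pos_def_def dims
    proof (intro conjI ballI impI)
      show "symmetric_mat I" unfolding I_def by (rule symmetric_mat_diag)
      fix x :: "real vec" assume x: "x \<in> carrier_vec p" "x \<noteq> 0\<^sub>v p"
      then obtain i where "i < p" "x $ i \<noteq> 0"
        by (metis eq_vecI index_zero_vec carrier_vecD)
      then show "0 < x \<bullet> (I *\<^sub>v x)"
        unfolding form[OF x(1)] using \<epsilon>(1) by (intro sum_pos2[of _ i]) auto
    qed
    ultimately show ?thesis unfolding def_less_def using sym sum dims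
      by (simp add: symmetric_mat_uminus)
  qed
  ultimately show "\<exists>Y \<in> carrier_mat p p. symmetric_mat Y \<and> Y \<prec>\<^sub>d - Z \<and> reduced_lmi (- Y) E t g"
    using ZI sum by (intro bexI[of _ "- (Z + I)"]) (auto simp: symmetric_mat_uminus)
next
  assume "\<exists>Y \<in> carrier_mat p p. symmetric_mat Y \<and> Y \<prec>\<^sub>d - Z \<and> reduced_lmi (- Y) E t g"
  then obtain Y where Y: "Y \<in> carrier_mat p p" and less: "Y \<prec>\<^sub>d - Z" and red: "reduced_lmi (- Y) E t g"
    by blast
  have nZ: "- Z \<in> carrier_mat p p" using Z by simp
  have dims: "dim_row Z = p" "dim_row E = n" "dim_row (- Y) = p" "dim_row (- Z - Y) = p"
    using Z E Y by auto
  show "reduced_lmi Z E t g" unfolding reduced_lmi_def dims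
  proof (intro conjI ballI impI)
    show "symmetric_mat Z" using less unfolding def_less_def by (simp add: symmetric_mat_uminus)
    fix x :: "real vec" assume x: "x \<in> carrier_vec p" "x \<noteq> 0\<^sub>v p"
    have "0 < x \<bullet> ((- Z - Y) *\<^sub>v x)"
      using less x unfolding def_less_def pos_def_def dims by blast
    then have "x \<bullet> (Z *\<^sub>v x) < - (x \<bullet> (Y *\<^sub>v x))"
      unfolding quadratic_form_minus[OF nZ Y x(1)] quadratic_form_uminus[OF Z x(1)] by simp
    moreover have "- (x \<bullet> (Y *\<^sub>v x)) + (\<Sum>i<p. t i * (x $ i)\<^sup>2) + (\<Sum>j<n. g j * (row E j \<bullet> x)\<^sup>2) < 0"
      using red x unfolding reduced_lmi_def dims quadratic_form_uminus[OF Y x(1), symmetric] by blast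
    ultimately show "x \<bullet> (Z *\<^sub>v x) + (\<Sum>i<p. t i * (x $ i)\<^sup>2) + (\<Sum>j<n. g j * (row E j \<bullet> x)\<^sup>2) < 0"
      by linarith
  qed
qed

section \<open>The matrices of the network\<close>

lemma N_uw_carrier:
  assumes "well_formed_network N"
  shows "N_uw N \<in> carrier_mat (out_dim N) (act_dim N)"
proof -
  have W: "weight N (depth N + 1) \<in> carrier_mat (out_dim N) (width N (depth N))"
    using assms unfolding well_formed_network_def by (auto dest!: bspec[of _ _ "depth N + 1"])
  have "width N (depth N) \<le> act_dim N"
    using assms unfolding well_formed_network_def act_dim_def by (intro member_le_sum) auto
  then show ?thesis using W unfolding N_uw_def append_cols_def by (intro carrier_matI) auto
qed

text \<open>On the reals \<open>INF\<close> and \<open>SUP\<close> compare only over bounded nonempty families. The entries are bounded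
because those of \<open>B\<close> range over a box, and the box contains \<open>Bl\<close>.\<close>
lemma B_N_lower_le_upper:
  assumes wf: "well_formed_network N"
    and Bl: "Bl \<in> carrier_mat (in_dim N) (out_dim N)" and Bu: "Bu \<in> carrier_mat (in_dim N) (out_dim N)"
    and le: "Bl \<le> Bu" and i: "i < in_dim N" and j: "j < act_dim N"
  shows "B_N_lower N Bl Bu $$ (i, j) \<le> B_N_upper N Bl Bu $$ (i, j)"
proof -
  let ?f = "\<lambda>B. (B * N_uw N) $$ (i, j)"
  define K where "K = (\<Sum>k<out_dim N. (\<bar>Bl $$ (i, k)\<bar> + \<bar>Bu $$ (i, k)\<bar>) * \<bar>N_uw N $$ (k, j)\<bar>)"
  have bound: "\<bar>?f B\<bar> \<le> K" if B: "B \<in> {Bl..Bu}" for B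
  proof -
    have Bc: "B \<in> carrier_mat (in_dim N) (out_dim N)"
      and B_le: "\<And>k. k < out_dim N \<Longrightarrow> Bl $$ (i, k) \<le> B $$ (i, k) \<and> B $$ (i, k) \<le> Bu $$ (i, k)"
    proof -
      have le: "Bl \<le> B" "B \<le> Bu" using B by simp_all
      then have dim: "dim_row B = in_dim N" "dim_col B = out_dim N"
        using Bl unfolding less_eq_mat_def by simp_all
      then show "B \<in> carrier_mat (in_dim N) (out_dim N)" by (intro carrier_matI)
      show "Bl $$ (i, k) \<le> B $$ (i, k) \<and> B $$ (i, k) \<le> Bu $$ (i, k)" if "k < out_dim N" for k
        using le i that Bl Bu dim unfolding less_eq_mat_def by simp
    qed
    have "?f B = (\<Sum>k<out_dim N. B $$ (i, k) * N_uw N $$ (k, j))"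
      using Bc N_uw_carrier[OF wf] i j by (auto simp: scalar_prod_def atLeast0LessThan)
    also have "\<bar>\<dots>\<bar> \<le> (\<Sum>k<out_dim N. \<bar>B $$ (i, k) * N_uw N $$ (k, j)\<bar>)" by (rule sum_abs)
    also have "\<dots> \<le> K" unfolding K_def abs_mult
    proof (intro sum_mono mult_right_mono)
      fix k assume "k \<in> {..<out_dim N}"
      then show "\<bar>B $$ (i, k)\<bar> \<le> \<bar>Bl $$ (i, k)\<bar> + \<bar>Bu $$ (i, k)\<bar>" using B_le[of k] by auto
    qed simp
    finally show ?thesis .
  qed
  have Bl_in: "Bl \<in> {Bl..Bu}" using le by simp
  have "bdd_below (?f ` {Bl..Bu})"
    by (intro bdd_belowI2[of _ "- K"]) (use bound in \<open>force simp: abs_le_iff\<close>)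
  then have "(INF B \<in> {Bl..Bu}. ?f B) \<le> ?f Bl" by (rule cINF_lower[OF _ Bl_in])
  also have "bdd_above (?f ` {Bl..Bu})"
    by (intro bdd_aboveI2[of _ _ K]) (use bound in \<open>force simp: abs_le_iff\<close>)
  then have "?f Bl \<le> (SUP B \<in> {Bl..Bu}. ?f B)" by (rule cSUP_upper[OF Bl_in])
  finally show ?thesis using i j unfolding B_N_lower_def B_N_upper_def by simp
qed

lemma D_mat_carrier:
  assumes "Al \<in> carrier_mat (in_dim N) (in_dim N)" "Au \<in> carrier_mat (in_dim N) (in_dim N)"
  shows "D_mat N Al Au Bl Bu \<in> carrier_mat (hat_dim N) (in_dim N)"
  using assms unfolding D_mat_def append_cols_def radius_mat_def B_tilde_r_def B_N_lower_def B_N_upper_def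
    hat_dim_def by (intro carrier_matI) auto

text \<open>The entries are interval radii or zero. Their sign is what makes \<open>T - D S D\<^sup>T\<close> have nonpositive
off-diagonal entries.\<close>
lemma D_mat_nonneg:
  assumes wf: "well_formed_network N"
    and A: "Al \<in> carrier_mat (in_dim N) (in_dim N)" "Au \<in> carrier_mat (in_dim N) (in_dim N)"
    and B: "Bl \<in> carrier_mat (in_dim N) (out_dim N)" "Bu \<in> carrier_mat (in_dim N) (out_dim N)"
    and le: "Al \<le> Au" "Bl \<le> Bu" and ij: "i < hat_dim N" "j < in_dim N"
  shows "0 \<le> D_mat N Al Au Bl Bu $$ (i, j)"
proof -
  let ?R = "radius_mat Al Au" and ?B = "B_tilde_r N Bl Bu"
  have R: "?R \<in> carrier_mat (in_dim N) (in_dim N)" using A by (auto simp: radius_mat_def)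
  have Bt: "?B \<in> carrier_mat (in_dim N) (act_dim N)"
    by (auto simp: B_tilde_r_def radius_mat_def B_N_lower_def B_N_upper_def)
  have R0: "0 \<le> ?R $$ (j, k)" if "k < in_dim N" for k
    using that ij A le(1) by (auto simp: radius_mat_def less_eq_mat_def)
  have B0: "0 \<le> ?B $$ (j, k)" if "k < act_dim N" for k
    using that ij B_N_lower_le_upper[OF wf B le(2) ij(2) that]
    by (auto simp: B_tilde_r_def radius_mat_def B_N_lower_def B_N_upper_def)
  show ?thesis
    using ij R Bt R0 B0 unfolding D_mat_def append_cols_def hat_dim_def by auto
qed

lemma Z_mat_carrier:
  assumes wf: "well_formed_network N"
    and P: "P \<in> carrier_mat (in_dim N) (in_dim N)"
  shows "Z_mat N Al Au Bl Bu \<alpha> \<beta> lam P \<in> carrier_mat (hat_dim N) (hat_dim N)"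
proof -
  have W: "dim_col (weight N 1) = in_dim N"
    using wf unfolding well_formed_network_def by force
  have "dim_row (X_mat N \<alpha> \<beta> lam) = in_dim N + act_dim N" "dim_col (X_mat N \<alpha> \<beta> lam) = in_dim N + act_dim N"
    using W by (auto simp: X_mat_def R_phi_def N_vx_def N_vw_def append_rows_def)
  then show ?thesis
    using P by (intro carrier_matI) (auto simp: Z_mat_def Let_def hat_dim_def)
qed

text \<open>The definition stacks \<open>P\<close> itself below the zero block, so agreement with a transpose uses the
symmetry of \<open>P\<close>.\<close>
lemma U_mat_eq:
  assumes P: "P \<in> carrier_mat (in_dim N) (in_dim N)" and sym: "symmetric_mat P"
  shows "U_mat N P = replicate_block (hat_dim N) (0\<^sub>m (in_dim N) (in_dim N + act_dim N) @\<^sub>c P)"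
proof -
  have "0 < in_dim N" if "k < hat_dim N * in_dim N" for k using that by (cases "in_dim N") auto
  moreover have "P $$ (i, j) = P $$ (j, i)" if "i < in_dim N" "j < in_dim N" for i j
    using sym symmetric_mat_iff[OF P] that by blast
  ultimately show ?thesis
    using P by (intro eq_matI)
      (auto simp: U_mat_def replicate_block_def append_cols_def append_rows_def hat_dim_def mult_2)
qed

lemma gamma_sum_eq:
  "gamma_sum N D \<gamma> = mat_diag (hat_dim N) (\<lambda>i. \<Sum>j<in_dim N. \<gamma> i j * (D $$ (i, j))\<^sup>2)"
proof (intro eq_matI)
  fix r c assume "r < dim_row (mat_diag (hat_dim N) (\<lambda>i. \<Sum>j<in_dim N. \<gamma> i j * (D $$ (i, j))\<^sup>2))"
    "c < dim_col (mat_diag (hat_dim N) (\<lambda>i. \<Sum>j<in_dim N. \<gamma> i j * (D $$ (i, j))\<^sup>2))"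
  then have rc: "r < hat_dim N" "c < hat_dim N" by (auto simp: mat_diag_def)
  have "gamma_sum N D \<gamma> $$ (r, c) = (\<Sum>i<hat_dim N. \<Sum>j<in_dim N. \<gamma> i j * (D $$ (i, j))\<^sup>2 *
      (unit_vec (hat_dim N) i $ r * unit_vec (hat_dim N) i $ c))"
    using rc unfolding gamma_sum_def by simp
  also have "\<dots> = (\<Sum>i<hat_dim N.
      if i = r then (if r = c then \<Sum>j<in_dim N. \<gamma> r j * (D $$ (r, j))\<^sup>2 else 0) else 0)"
  proof (rule sum.cong[OF refl])
    fix i assume "i \<in> {..<hat_dim N}"
    then show "(\<Sum>j<in_dim N. \<gamma> i j * (D $$ (i, j))\<^sup>2 *
        (unit_vec (hat_dim N) i $ r * unit_vec (hat_dim N) i $ c))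
      = (if i = r then (if r = c then \<Sum>j<in_dim N. \<gamma> r j * (D $$ (r, j))\<^sup>2 else 0) else 0)"
      using rc by (cases "i = r"; cases "r = c") simp_all
  qed
  finally show "gamma_sum N D \<gamma> $$ (r, c)
      = mat_diag (hat_dim N) (\<lambda>i. \<Sum>j<in_dim N. \<gamma> i j * (D $$ (i, j))\<^sup>2) $$ (r, c)"
    using rc by (simp add: mat_diag_def)
qed (auto simp: gamma_sum_def mat_diag_def)

section \<open>The equivalence theorem\<close>

text \<open>The three conditions share the requirements on \<open>P\<close> and \<open>lam\<close>, so they are compared for one such
pair at a time.\<close>
lemma LMI_iff_reduced_lmi:
  fixes N :: network and Al Au Bl Bu :: "real mat" and \<alpha> \<beta> v_star v1_bar :: "real vec"
  assumes wf: "well_formed_network N"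
  defines "n \<equiv> in_dim N" and "p \<equiv> hat_dim N" and "D \<equiv> D_mat N Al Au Bl Bu"
    and "Z \<equiv> Z_mat N Al Au Bl Bu \<alpha> \<beta>"
    and "E \<equiv> \<lambda>P. 0\<^sub>m (in_dim N) (in_dim N + act_dim N) @\<^sub>c P"
    and "admissible \<equiv> \<lambda>P lam. P \<in> carrier_mat (in_dim N) (in_dim N) \<and> pos_def P \<and>
        lam \<in> carrier_vec (act_dim N) \<and> 0\<^sub>v (act_dim N) \<le> lam \<and> cond_N N v_star v1_bar P"
  shows "LMI_I N Al Au Bl Bu \<alpha> \<beta> v_star v1_bar \<longleftrightarrow> (\<exists>P lam. admissible P lam \<and>
      (\<exists>\<gamma>. (\<forall>i<p. \<forall>j<n. 0 < \<gamma> i j) \<and> reduced_lmi (Z lam P) (E P)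
        (\<lambda>i. \<Sum>j<n. \<gamma> i j * (D $$ (i, j))\<^sup>2) (\<lambda>j. \<Sum>i<p. 1 / \<gamma> i j)))" (is "_ \<longleftrightarrow> ?R1")
    and "LMI_II N Al Au Bl Bu \<alpha> \<beta> v_star v1_bar \<longleftrightarrow> (\<exists>P lam. admissible P lam \<and>
      (\<exists>t s. (\<forall>j<n. 0 < s j) \<and> D * mat_diag n s * transpose_mat D \<prec>\<^sub>d mat_diag p t \<and>
        reduced_lmi (Z lam P) (E P) t (\<lambda>j. 1 / s j)))" (is "_ \<longleftrightarrow> ?R2")
    and "LMI_III N Al Au Bl Bu \<alpha> \<beta> v_star v1_bar \<longleftrightarrow> (\<exists>P lam. admissible P lam \<and>
      (\<exists>\<gamma>. (\<forall>i<p. \<forall>j<n. 0 < \<gamma> i j) \<and>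
        (\<exists>Y \<in> carrier_mat p p. symmetric_mat Y \<and> Y \<prec>\<^sub>d - Z lam P \<and> reduced_lmi (- Y) (E P)
          (\<lambda>i. \<Sum>j<n. \<gamma> i j * (D $$ (i, j))\<^sup>2) (\<lambda>j. \<Sum>i<p. 1 / \<gamma> i j))))" (is "_ \<longleftrightarrow> ?R3")
proof -
  have Zc: "Z lam P \<in> carrier_mat p p" if "admissible P lam" for P lam
    using that Z_mat_carrier[OF wf] unfolding admissible_def Z_def p_def by blast
  have Ec: "E P \<in> carrier_mat n p" if "admissible P lam" for P lam
    using that unfolding E_def n_def p_def hat_dim_def append_cols_def admissible_def
    by (intro carrier_matI) auto
  have U: "U_mat N P = replicate_block p (E P)" if "admissible P lam" for P lam
    using that unfolding admissible_def pos_def_def p_def E_def by (intro U_mat_eq) auto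
  have V: "V_mat N \<gamma> = mat_diag (p * n) (\<lambda>k. \<gamma> (k div n) (k mod n))" for \<gamma>
    unfolding V_mat_def p_def n_def ..
  have G: "gamma_sum N D \<gamma> = mat_diag p (\<lambda>i. \<Sum>j<n. \<gamma> i j * (D $$ (i, j))\<^sup>2)" for \<gamma>
    unfolding p_def n_def by (rule gamma_sum_eq)
  note I = replicated_block_neg_def_iff[OF Zc Ec] and II = diagonal_block_neg_def_iff[OF Zc Ec] and III = replicated_block_pos_def_iff[OF _ Ec]

  have "LMI_I N Al Au Bl Bu \<alpha> \<beta> v_star v1_bar \<longleftrightarrow> (\<exists>P lam. admissible P lam \<and>
      (\<exists>\<gamma>. (\<forall>i<p. \<forall>j<n. 0 < \<gamma> i j) \<and>
        four_block_mat (Z lam P + gamma_sum N D \<gamma>) (U_mat N P) (transpose_mat (U_mat N P)) (- V_mat N \<gamma>)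
          \<prec>\<^sub>d 0\<^sub>m (p + p * n) (p + p * n)))"
    unfolding LMI_I_def Let_def n_def p_def D_def Z_def admissible_def by (intro iffI; elim exE conjE; blast)
  also have "\<dots> \<longleftrightarrow> ?R1"
    by (intro ex_cong1 conj_cong refl) (simp add: U V G I)
  finally show "LMI_I N Al Au Bl Bu \<alpha> \<beta> v_star v1_bar \<longleftrightarrow> ?R1" .

  have "LMI_II N Al Au Bl Bu \<alpha> \<beta> v_star v1_bar \<longleftrightarrow> (\<exists>P lam. admissible P lam \<and>
      (\<exists>T S. (T \<in> carrier_mat p p \<and> diagonal_mat T) \<and> (S \<in> carrier_mat n n \<and> diagonal_mat S) \<and>
        D * S * transpose_mat D \<prec>\<^sub>d T \<and>
        four_block_mat (Z lam P + T) (transpose_mat (E P)) (E P) (- S) \<prec>\<^sub>d 0\<^sub>m (p + n) (p + n)))"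
    unfolding LMI_II_def Let_def n_def p_def D_def Z_def admissible_def E_def
    by (intro iffI; elim exE conjE; blast)
  also have "\<dots> \<longleftrightarrow> (\<exists>P lam. admissible P lam \<and>
      (\<exists>t s. D * mat_diag n s * transpose_mat D \<prec>\<^sub>d mat_diag p t \<and>
        four_block_mat (Z lam P + mat_diag p t) (transpose_mat (E P)) (E P) (- mat_diag n s)
          \<prec>\<^sub>d 0\<^sub>m (p + n) (p + n)))"
  proof -
    have diag: "(\<exists>A. (A \<in> carrier_mat k k \<and> diagonal_mat A) \<and> Q A) \<longleftrightarrow> (\<exists>a. Q (mat_diag k a))"
      for k and Q :: "real mat \<Rightarrow> bool"
    proof
      assume "\<exists>A. (A \<in> carrier_mat k k \<and> diagonal_mat A) \<and> Q A"
      then show "\<exists>a. Q (mat_diag k a)" using diagonal_mat_eq_mat_diag by metis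
    next
      assume "\<exists>a. Q (mat_diag k a)"
      moreover have "mat_diag k a \<in> carrier_mat k k" "diagonal_mat (mat_diag k a)" for a :: "nat \<Rightarrow> real"
        by (simp, auto simp: diagonal_mat_def mat_diag_def)
      ultimately show "\<exists>A. (A \<in> carrier_mat k k \<and> diagonal_mat A) \<and> Q A" by blast
    qed
    show ?thesis by (simp only: ex_simps diag)
  qed
  also have "\<dots> \<longleftrightarrow> ?R2"
    by ((rule ex_cong1)+, rule conj_cong[OF refl], (rule ex_cong1)+, auto simp: II)
  finally show "LMI_II N Al Au Bl Bu \<alpha> \<beta> v_star v1_bar \<longleftrightarrow> ?R2" .

  have "LMI_III N Al Au Bl Bu \<alpha> \<beta> v_star v1_bar \<longleftrightarrow> (\<exists>P lam. admissible P lam \<and>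
      (\<exists>\<gamma>. (\<forall>i<p. \<forall>j<n. 0 < \<gamma> i j) \<and> (\<exists>Y \<in> carrier_mat p p. symmetric_mat Y \<and> Y \<prec>\<^sub>d - Z lam P \<and>
        0\<^sub>m (p + p * n) (p + p * n) \<prec>\<^sub>d four_block_mat (Y - gamma_sum N D \<gamma>)
          (U_mat N P) (transpose_mat (U_mat N P)) (V_mat N \<gamma>))))"
    unfolding LMI_III_def Let_def n_def p_def D_def Z_def admissible_def
    by (intro iffI; elim exE conjE bexE; blast)
  also have "\<dots> \<longleftrightarrow> ?R3"
    by (intro ex_cong1 conj_cong bex_cong refl) (simp add: U V G III)
  finally show "LMI_III N Al Au Bl Bu \<alpha> \<beta> v_star v1_bar \<longleftrightarrow> ?R3" .
qed

theorem mainTheorem4: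
  fixes N :: network
    and Al Au Ad Bl Bu Bd :: "real mat"
    and x :: "nat \<Rightarrow> real vec"
    and x_star u_star v_star w_star v1_bar \<alpha> \<beta> :: "real vec"
  assumes "well_formed_network N"
    and "Al \<in> carrier_mat (in_dim N) (in_dim N)" "Au \<in> carrier_mat (in_dim N) (in_dim N)"
    and "Bl \<in> carrier_mat (in_dim N) (out_dim N)" "Bu \<in> carrier_mat (in_dim N) (out_dim N)"
    and "Al \<le> Au" "Bl \<le> Bu"
    and "Ad \<in> {Al..Au}" "Bd \<in> {Bl..Bu}"
    and "closed_loop Ad Bd N x"
    and "x_star = 0\<^sub>v (in_dim N)" "u_star = 0\<^sub>v (out_dim N)"
    and "network_map N x_star = u_star"
    and "v_star = stacked_in N x_star" "w_star = stacked_out N x_star"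
    and "v1_bar \<in> carrier_vec (width N 1)"
    and "\<alpha> \<in> carrier_vec (act_dim N)" "\<beta> \<in> carrier_vec (act_dim N)" "\<alpha> \<le> \<beta>"
  shows "(LMI_I N Al Au Bl Bu \<alpha> \<beta> v_star v1_bar \<longleftrightarrow> LMI_II N Al Au Bl Bu \<alpha> \<beta> v_star v1_bar) \<and>
         (LMI_II N Al Au Bl Bu \<alpha> \<beta> v_star v1_bar \<longleftrightarrow> LMI_III N Al Au Bl Bu \<alpha> \<beta> v_star v1_bar)"
proof -
  let ?n = "in_dim N" and ?p = "hat_dim N" and ?D = "D_mat N Al Au Bl Bu"
  let ?Z = "Z_mat N Al Au Bl Bu \<alpha> \<beta>" and ?E = "\<lambda>P. 0\<^sub>m (in_dim N) (in_dim N + act_dim N) @\<^sub>c P"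
  have Z: "?Z lam P \<in> carrier_mat ?p ?p" if "P \<in> carrier_mat ?n ?n" for lam P
    by (rule Z_mat_carrier[OF assms(1) that])
  have E: "?E P \<in> carrier_mat ?n ?p" if "P \<in> carrier_mat ?n ?n" for P
    using that unfolding hat_dim_def append_cols_def by (intro carrier_matI) auto
  have np: "?n \<le> ?p" by (simp add: hat_dim_def)
  have D: "?D \<in> carrier_mat ?p ?n" by (rule D_mat_carrier[OF assms(2,3)])
  have nonneg: "0 \<le> ?D $$ (i, j)" if "i < ?p" "j < ?n" for i j
    by (rule D_mat_nonneg[OF assms(1-7) that])
  note iffs = LMI_iff_reduced_lmi[OF assms(1)]
  have "LMI_I N Al Au Bl Bu \<alpha> \<beta> v_star v1_bar \<longleftrightarrow> LMI_II N Al Au Bl Bu \<alpha> \<beta> v_star v1_bar"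
    unfolding iffs(1,2)
    by (intro ex_cong1 conj_cong refl multipliers_iff_diagonal[OF Z E np D nonneg]) simp_all
  moreover have "LMI_I N Al Au Bl Bu \<alpha> \<beta> v_star v1_bar \<longleftrightarrow> LMI_III N Al Au Bl Bu \<alpha> \<beta> v_star v1_bar"
    unfolding iffs(1,3)
    by (intro ex_cong1 conj_cong refl reduced_lmi_iff_majorant[OF Z E]) simp_all
  ultimately show ?thesis by simp
qed

end
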